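(* The algorithm ALG2 (defined in the context) is $4.62$-competitive for the problem BipartiteMatching2. That is, for every complete bipartite graph $G=(L,R,W)$ with $|R|=n$, $|L|=n/2$, every vertex of $L$ of capacity $2$, and arbitrary non-negative edge weights $W$, if the vertices of $R$ arrive in uniformly random order, then the capacitated matching $M$ output by ALG2 satisfies $\mathbb{E}[w(M)]\ge \mathrm{OPT}/4.62$, where $w(M)$ is the total weight of $M$, $\mathrm{OPT}$ is the maximum weight of a capacitated matching of $G$ matching all of $R$, and the expectation is over the arrival order and the random choices of the algorithm.
   Context: BipartiteMatching2 (no rejections): $G=(L,R,W)$ is a complete bipartite graph with non-negative edge weights, $|R|=n$ ($n$ even), $|L|=n/2$. The vertices of $L$ are offline (known from the outset), each with capacity $2$, meaning that it may be matched to at most two vertices of $R$. The vertices of $R$ are online: they arrive one at a time in a uniformly random order, revealing on arrival the weights of their edges to $L$. Each arriving vertex must be matched irrevocably, upon arrival, to exactly one vertex of $L$ with remaining capacity. A (valid) capacitated matching is a set of edges in which each vertex of $R$ has degree at most $1$ and each vertex of $L$ has degree at most $2$; its weight $w(M)$ is the sum of its edge weights. Online vertices are named $1,\dots,n$ in order of arrival. ALG2. Start with $M=\emptyset$ and $L_a=L$. For each arriving vertex $v=1,\dots,n$, let $R'=\{1,\dots,v\}$. - If $v<\lfloor n/4\rfloor$ (exploration): choose $v'\in L_a$ uniformly at random, add $(v',v)$ to $M$, and remove $v'$ from $L_a$. - Otherwise (exploitation): compute $M^v$, a maximum-weight capacitated matching between $L$ and $R'$ that matches every vertex of $R'$ (ties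 broken by a fixed rule depending only on the set $R'$ and not on the arrival order). Let $e^v$ be the edge of $M^v$ incident to $v$ and $l(e^v)\in L$ its offline endpoint. If $M\cup\{e^v\}$ is a valid capacitated matching, add $e^v$ to $M$ and set $L_a\leftarrow L_a\setminus\{l(e^v)\}$. Otherwise choose $v'\in L_a$ uniformly at random, add $(v',v)$ to $M$, and remove $v'$ from $L_a$. - At the end of the step, if $L_a=\emptyset$, reset $L_a$ to the set of vertices of $L$ that are not matched to full capacity in $M$. Output $M$. The random choices of the algorithm are independent of the arrival order. *)

theory Defs
  imports "HOL-Probability.Probability" "HOL-Combinatorics.Multiset_Permutations"
begin

type_synonym ('l, 'r) matching = "('l \<times> 'r) set"

definition cap_matching :: "'l set \<Rightarrow> 'r set \<Rightarrow> ('l, 'r) matching \<Rightarrow> bool" where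
  "cap_matching L R M \<longleftrightarrow>
     M \<subseteq> L \<times> R \<and>
     (\<forall>r\<in>R. card {l. (l, r) \<in> M} \<le> 1) \<and>
     (\<forall>l\<in>L. card {r. (l, r) \<in> M} \<le> 2)"

definition matches_all :: "'r set \<Rightarrow> ('l, 'r) matching \<Rightarrow> bool" where
  "matches_all R M \<longleftrightarrow> (\<forall>r\<in>R. \<exists>l. (l, r) \<in> M)"

definition weight :: "('l \<Rightarrow> 'r \<Rightarrow> real) \<Rightarrow> ('l, 'r) matching \<Rightarrow> real" where
  "weight w M = (\<Sum>(l, r)\<in>M. w l r)"

definition is_max_matching ::
  "'l set \<Rightarrow> 'r set \<Rightarrow> ('l \<Rightarrow> 'r \<Rightarrow> real) \<Rightarrow> ('l, 'r) matching \<Rightarrow> bool" where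
  "is_max_matching L R w M \<longleftrightarrow>
     cap_matching L R M \<and> matches_all R M \<and>
     (\<forall>M'. cap_matching L R M' \<and> matches_all R M' \<longrightarrow> weight w M' \<le> weight w M)"

definition OPT :: "'l set \<Rightarrow> 'r set \<Rightarrow> ('l \<Rightarrow> 'r \<Rightarrow> real) \<Rightarrow> real" where
  "OPT L R w = Max (weight w ` {M. cap_matching L R M \<and> matches_all R M})"

text \<open>
  A state of the algorithm is the pair of the current matching \<open>M\<close> and the set \<open>La\<close> of available
  offline vertices.
\<close>

type_synonym ('l, 'r) alg_state = "('l, 'r) matching \<times> 'l set"

definition match_random :: "'r \<Rightarrow> ('l, 'r) alg_state \<Rightarrow> ('l, 'r) alg_state pmf" where
  "match_random r = (\<lambda>(M, La).
     map_pmf (\<lambda>l. (insert (l, r) M, La - {l})) (pmf_of_set La))"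

definition reset_available :: "'l set \<Rightarrow> ('l, 'r) alg_state \<Rightarrow> ('l, 'r) alg_state" where
  "reset_available L = (\<lambda>(M, La).
     if La = {} then (M, {l\<in>L. card {r. (l, r) \<in> M} < 2}) else (M, La))"

text \<open>
  The processing of the \<open>v\<close>-th arrival \<open>r\<close> (counted from 1), where \<open>R'\<close> is the set of the first
  \<open>v\<close> arrivals and \<open>n\<close> is the total number of online vertices. The function \<open>opt\<close> is the
  tie-breaking rule: \<open>opt R'\<close> is the selected maximum-weight matching of \<open>R'\<close>. The algorithm
  sees the weights only through \<open>opt\<close>.

  The set \<open>La\<close> in \<open>match_random\<close> is never empty: it contains only vertices of \<open>L\<close> with remaining
  capacity, and if it is still empty after a reset then \<open>M\<close> has \<open>2 * card L = n\<close> edges, so that all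
  online vertices have arrived.
\<close>

definition alg2_step ::
  "'l set \<Rightarrow> ('r set \<Rightarrow> ('l, 'r) matching) \<Rightarrow> nat \<Rightarrow> nat \<Rightarrow> 'r set \<Rightarrow> 'r \<Rightarrow>
   ('l, 'r) alg_state \<Rightarrow> ('l, 'r) alg_state pmf" where
  "alg2_step L opt n v R' r = (\<lambda>(M, La).
     map_pmf (reset_available L)
       (if v < n div 4 then match_random r (M, La)
        else let l = (THE l. (l, r) \<in> opt R') in
          if cap_matching L R' (insert (l, r) M)
          then return_pmf (insert (l, r) M, La - {l})
          else match_random r (M, La)))"

text \<open>The state after the first \<open>v\<close> arrivals of the arrival order \<open>xs\<close>:\<close>

primrec alg2_state ::
  "'l set \<Rightarrow> ('r set \<Rightarrow> ('l, 'r) matching) \<Rightarrow> 'r list \<Rightarrow> nat \<Rightarrow> ('l, 'r) alg_state pmf" where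
  "alg2_state L opt xs 0 = return_pmf ({}, L)"
| "alg2_state L opt xs (Suc v) =
     bind_pmf (alg2_state L opt xs v)
       (alg2_step L opt (length xs) (Suc v) (set (take (Suc v) xs)) (xs ! v))"

definition alg2 ::
  "'l set \<Rightarrow> ('r set \<Rightarrow> ('l, 'r) matching) \<Rightarrow> 'r list \<Rightarrow> ('l, 'r) matching pmf" where
  "alg2 L opt xs = map_pmf fst (alg2_state L opt xs (length xs))"

text \<open>The output distribution when the online vertices arrive in uniformly random order:\<close>

definition alg2_random_order ::
  "'l set \<Rightarrow> 'r set \<Rightarrow> ('r set \<Rightarrow> ('l, 'r) matching) \<Rightarrow> ('l, 'r) matching pmf" where
  "alg2_random_order L R opt = bind_pmf (pmf_of_set (permutations_of_set R)) (alg2 L opt)"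

end

theory Submission
  imports Defs
begin

text \<open>
  Write \<open>m = card L\<close>, \<open>n = 2 * m\<close>. As long as some offline vertex is unmatched the available
  vertices are exactly the unmatched ones; afterwards they are the vertices of degree one. Hence the
  state is determined by the matching alone. Conditionally on the set \<open>T\<close> of the first \<open>k\<close> arrivals
  the last one is uniform in \<open>T\<close> and the order of the others is uniform, so the chance that the \<open>k\<close>-th
  arrival can follow the optimal matching satisfies a recursion in \<open>k\<close>: a fixed offline vertex is the
  partner of the last arrival with probability at most \<open>2 / k\<close>, and is otherwise hit only by the
  random choice among at least \<open>m - k + 1\<close> available vertices.

  The random choice happens only if the partner of the last arrival is already full. Dropping
  this condition would give only the ratio \<open>4.84\<close>. So for two vertices \<open>l\<close>, \<open>l'\<close> the probability that
  \<open>l\<close> is unmatched and \<open>l'\<close> has a free place is bounded as well. With \<open>u = 4 * k / n\<close> the asymptotic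
  lower bounds are \<open>(2 - u) / (2 * u)\<close> for "\<open>l\<close> is unmatched", and for "\<open>l\<close> has a free place"
  \<open>2 / u - 1 / (2 * u\<^sup>2) - 1 / 2\<close> if \<open>u \<le> 2\<close> and \<open>3 / 4 * (4 - u) / u\<^sup>2\<close> if \<open>u \<ge> 2\<close>. Their integral over
  \<open>1 \<le> u \<le> 4\<close> is \<open>4 * 0.2166\<close>, just above \<open>4 / 4.62\<close>.
\<close>

section \<open>Elementary estimates\<close>

lemma ln_2_bounds: "6931 / 10000 \<le> ln (2::real)" "ln (2::real) \<le> 6932 / 10000"
proof -
  have "ln (2::real) \<in> {\<Sum>k<4. 2 * (1/3)^(2*k+1) / of_nat (2*k+1)..
      (\<Sum>k<4. 2 * (1/3)^(2*k+1) / of_nat (2*k+1)) + 2 * ((1/3)^(2*4+1) / (1 - (1/3)^2) / of_nat (2*4+1))}"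
    using ln_approx_bounds[of 2 4] by simp
  then show "6931 / 10000 \<le> ln (2::real)" "ln (2::real) \<le> 6932 / 10000"
    by (simp_all add: lessThan_nat_numeral lessThan_Suc power_divide)
qed

text \<open>The left side is a Pade approximant that agrees with the logarithm up to second order at
  \<open>0\<close>. This is sharp enough both for harmonic sums and for the rounding corrections in
  \<open>first_half_sum\<close>.\<close>

lemma ln_quotient_ge:
  fixes x :: real
  assumes "0 \<le> x"
  shows "2 * x / (2 + x) \<le> ln (1 + x)"
proof -
  let ?h = "\<lambda>x. ln (1 + x) - 2 * x / (2 + x)"
  have "?h 0 \<le> ?h x"
  proof (rule DERIV_nonneg_imp_nondecreasing[OF assms])
    fix y :: real assume y: "0 \<le> y" "y \<le> x"
    have "(?h has_real_derivative (1 / (1 + y) - (2 * (2 + y) - 2 * y) / (2 + y)\<^sup>2)) (at y)"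
      using y by (auto intro!: derivative_eq_intros simp: power2_eq_square)
    moreover have "1 / (1 + y) - (2 * (2 + y) - 2 * y) / (2 + y)\<^sup>2 = y\<^sup>2 / ((1 + y) * (2 + y)\<^sup>2)"
      using y by (simp add: divide_simps) (simp add: algebra_simps power2_eq_square)
    ultimately show "\<exists>d. (?h has_real_derivative d) (at y) \<and> 0 \<le> d" using y by auto
  qed
  then show ?thesis by simp
qed

text \<open>The trapezoid rule overestimates the integral of the convex function
  \<open>1 / x\<close> over the interval from \<open>k\<close> to \<open>k + 1\<close>.\<close>

lemma ln_Suc_le:
  assumes "0 < k"
  shows "ln (real k + 1) - ln (real k) \<le> (1 / real k + 1 / (real k + 1)) / 2"
proof -
  define x where "x = 1 / (real k)"
  have x: "0 < x" using assms by (simp add: x_def)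
  let ?h = "\<lambda>x. (x + x / (1 + x)) / 2 - ln (1 + x)"
  have "?h 0 \<le> ?h x"
  proof (rule DERIV_nonneg_imp_nondecreasing[OF less_imp_le[OF x]])
    fix y :: real assume y: "0 \<le> y" "y \<le> x"
    have "(?h has_real_derivative ((1 + ((1 + y) - y) / (1 + y)\<^sup>2) / 2 - 1 / (1 + y))) (at y)"
      using y by (auto intro!: derivative_eq_intros simp: power2_eq_square)
    moreover have "(1 + ((1 + y) - y) / (1 + y)\<^sup>2) / 2 - 1 / (1 + y) = y\<^sup>2 / (2 * (1 + y)\<^sup>2)"
      using y by (simp add: divide_simps) (simp add: algebra_simps power2_eq_square)
    ultimately show "\<exists>d. (?h has_real_derivative d) (at y) \<and> 0 \<le> d" using y by auto
  qed
  then have "ln (1 + x) \<le> (x + x / (1 + x)) / 2" by simp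
  moreover have "1 + x = (real k + 1) / real k" using assms by (simp add: x_def field_simps)
  then have "ln (1 + x) = ln (real k + 1) - ln (real k)" using assms by (simp add: ln_div)
  moreover have "x / (1 + x) = 1 / (real k + 1)" using assms by (simp add: x_def field_simps)
  ultimately show ?thesis by (simp add: x_def)
qed

lemma sum_inverse_ge:
  assumes "0 < a" "a \<le> b"
  shows "ln (real b) - ln (real a) + (1 / real a - 1 / real b) / 2 \<le> (\<Sum>k=a..<b. 1 / real k)"
  using assms(2)
proof (induction b rule: dec_induct)
  case (step k)
  then show ?case
    using ln_Suc_le[of k] assms(1) by (simp add: add.commute diff_divide_distrib add_divide_distrib)
qed simp

text \<open>The midpoint rule underestimates the integral of \<open>1 / x\<close> over the interval
  from \<open>k - 1 / 2\<close> to \<open>k + 1 / 2\<close>.\<close>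

lemma ln_midpoint:
  assumes "0 < k"
  shows "1 / real k \<le> ln (2 * real k + 1) - ln (2 * real k - 1)"
proof -
  have k: "1 \<le> real k" using assms by simp
  define x where "x = 2 / (2 * real k - 1)"
  have "2 * x / (2 + x) = 1 / real k" using k by (simp add: x_def divide_simps)
  moreover have "1 + x = (2 * real k + 1) / (2 * real k - 1)" using k by (simp add: x_def field_simps)
  ultimately show ?thesis using ln_quotient_ge[of x] k by (simp add: x_def ln_div)
qed

lemma sum_inverse_le:
  assumes "0 < a" "a \<le> b"
  shows "(\<Sum>k=a..<b. 1 / real k) \<le> ln (2 * real b - 1) - ln (2 * real a - 1)"
  using assms(2)
proof (induction b rule: dec_induct)
  case (step k)
  then show ?case using ln_midpoint[of k] assms(1) by (simp add: algebra_simps)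
qed simp

lemma sum_inverse_consecutive:
  assumes "1 < a" "a \<le> b"
  shows "(\<Sum>k=a..<b. 1 / (real k * (real k - 1))) = 1 / (real a - 1) - 1 / (real b - 1)"
  using assms(2)
proof (induction b rule: dec_induct)
  case (step k)
  then have "1 / (real k * (real k - 1)) = 1 / (real k - 1) - 1 / real k"
    using assms(1) by (simp add: divide_simps)
  then show ?case using step by simp
qed simp

section \<open>Polynomial inequalities for the growth of \<open>eta\<close>\<close>

lemma eta_step_ineq:
  fixes s i m :: real
  assumes s: "11 \<le> s" and i: "0 \<le> i" and m: "m = 2 * s + 2 \<or> m = 2 * s + 3"
  shows "(s + i - 3) * (s + i - 4) * (2 * m - 3 * (s + i) + 2) * (m - 1)
    \<le> 2 * (m - (s + i) + 1) * (s + 5) * (s - 2) * (s - 3)" (is "?l \<le> ?r")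
proof -
  \<comment> \<open>With \<open>s = t + 11\<close> the difference of the two sides becomes a
    polynomial in \<open>t\<close>. Completing squares in \<open>i\<close> makes its coefficients
    visibly non-negative.\<close>
  obtain t where t: "s = t + 11" "0 \<le> t" using s by (metis add.commute le_add_diff_inverse diff_ge_0_iff_ge)
  from m show ?thesis
  proof
    assume m: "m = 2 * s + 3"
    have "?r - ?l = 72 * (i * (i - 3)\<^sup>2) + (1056 * (i - 2880 / 1056)\<^sup>2 + (9024 - 2880\<^sup>2 / 1056))
       + t * (172 * (i - 557 / 172)\<^sup>2 + (2312 - 557\<^sup>2 / 172) + 6 * i ^ 3)
       + t\<^sup>2 * (10 * (i - 29 / 10)\<^sup>2 + (180 - 29\<^sup>2 / 10)) + 4 * t ^ 3"
      unfolding m t(1) by (simp add: algebra_simps power2_eq_square power3_eq_cube)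
    moreover have "0 \<le> \<dots>" using t(2) i
      by (intro add_nonneg_nonneg mult_nonneg_nonneg) auto
    ultimately show ?thesis by simp
  next
    assume m: "m = 2 * s + 2"
    have "?r - ?l = 69 * i ^ 3 + (644 * (i - 4305 / 1288)\<^sup>2 + (10360 - 4305\<^sup>2 / 2576))
       + t * (171 * (i - 477 / 171)\<^sup>2 + (2879 - 477\<^sup>2 / 171) + 6 * i ^ 3)
       + t\<^sup>2 * (10 * (i - 51 / 20)\<^sup>2 + (254 - 51\<^sup>2 / 40)) + 7 * t ^ 3"
      unfolding m t(1) by (simp add: algebra_simps power2_eq_square power3_eq_cube)
    moreover have "0 \<le> \<dots>" using t(2) i
      by (intro add_nonneg_nonneg mult_nonneg_nonneg) auto
    ultimately show ?thesis by simp
  qed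
qed

text \<open>This is AM-GM for \<open>y / 2\<close>, \<open>y / 2\<close> and \<open>z\<close>. The
  equality case \<open>y = 2 * z\<close> explains the squared factor in the proof.\<close>

lemma square_mult_le_cube:
  fixes y z :: real
  assumes "0 \<le> y" "0 \<le> z"
  shows "27 * (y\<^sup>2 * z) \<le> 4 * (y + z) ^ 3"
proof -
  have "4 * (y + z) ^ 3 - 27 * (y\<^sup>2 * z) = (y - 2 * z)\<^sup>2 * (4 * y + z)"
    by (simp add: algebra_simps power2_eq_square power3_eq_cube)
  moreover have "0 \<le> \<dots>" using assms by (intro mult_nonneg_nonneg) auto
  ultimately show ?thesis by linarith
qed

lemma cubic_bound:
  fixes s j m :: real
  assumes s: "11 \<le> s" and j: "s \<le> j" "j \<le> m - 1" and m: "m \<le> 2 * s + 3"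
  shows "2 * ((j - 2) * (j - 3) * (m - j - 1)) \<le> 3 * ((s + 3) * (s - 2) * (s - 3))"
proof -
  obtain t where t: "s = t + 11" "0 \<le> t" using s by (metis add.commute le_add_diff_inverse diff_ge_0_iff_ge)
  \<comment> \<open>The square prepares for AM-GM: \<open>j - 5 / 2\<close> and
    \<open>m - j - 1\<close> have the constant sum \<open>m - 7 / 2\<close>.\<close>
  have "(j - 2) * (j - 3) * (m - j - 1) \<le> (j - 5/2)\<^sup>2 * (m - j - 1)"
    using j by (intro mult_right_mono) (simp_all add: power2_eq_square algebra_simps)
  also have "27 * \<dots> \<le> 4 * ((j - 5/2) + (m - j - 1)) ^ 3"
    using j s by (intro square_mult_le_cube) auto
  also have "\<dots> \<le> 4 * (2 * s - 1/2) ^ 3"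
    using m s j by (intro mult_left_mono power_mono) auto
  finally have 1: "27 * ((j - 2) * (j - 3) * (m - j - 1)) \<le> 4 * (2 * s - 1/2) ^ 3"
    by simp
  have "81 * ((s + 3) * (s - 2) * (s - 3)) - 8 * (2 * s - 1/2) ^ 3
      = 17 * t ^ 3 + 447 * t\<^sup>2 + 2922 * t + 2141"
    unfolding t(1) by (simp add: algebra_simps power2_eq_square power3_eq_cube)
  moreover have "0 \<le> 17 * t ^ 3 + 447 * t\<^sup>2 + 2922 * t + 2141" using t(2) by simp
  ultimately show ?thesis using 1 by linarith
qed

text \<open>The slope is \<open>2 * 0.6931 - 3 / 4\<close>, just below
  \<open>2 * ln 2 - 3 / 4\<close>, the integral of the asymptotic bound for a free place over
  \<open>1 \<le> u \<le> 2\<close>. The additive constants here and for odd \<open>m\<close> are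
  large enough for \<open>n = 4 * s + 4\<close> and \<open>n = 4 * s + 6\<close>.\<close>

lemma first_half_even:
  fixes s m :: real
  assumes "11 \<le> s" "m = 2 * s + 2"
  shows "6362/10000 * s + 101/100 \<le>
    s * (1 + (2 * m - s * (2 * m + 1 - s)) / (m * (s + 1))) * ((m - s) / (m - 1)) +
    s * (s - 1) * (2 * m * (6931/10000 + 2 / (2 * s + 1) + (1 / s - 1 / m) / 2) - (m - s)) / (m * (s + 1))" (is "?l \<le> ?r")
proof -
  obtain t where t: "s = t + 11" "0 \<le> t"
    using assms(1) by (metis add.commute le_add_diff_inverse diff_ge_0_iff_ge)
  have "0 \<le> ?r - ?l"
    unfolding assms(2) t(1) using t(2) by (simp add: divide_simps) (simp add: algebra_simps)
  then show ?thesis by simp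
qed

lemma first_half_odd:
  fixes s m :: real
  assumes "11 \<le> s" "m = 2 * s + 3"
  shows "6362/10000 * s + 145/100 \<le>
    s * (1 + (2 * m - s * (2 * m + 1 - s)) / (m * (s + 1))) * ((m - s) / (m - 1)) +
    s * (s - 1) * (2 * m * (6931/10000 + 6 / (4 * s + 3) + (1 / s - 1 / m) / 2) - (m - s)) / (m * (s + 1))" (is "?l \<le> ?r")
proof -
  obtain t where t: "s = t + 11" "0 \<le> t"
    using assms(1) by (metis add.commute le_add_diff_inverse diff_ge_0_iff_ge)
  have "0 \<le> ?r - ?l"
    unfolding assms(2) t(1) using t(2) by (simp add: divide_simps) (simp add: algebra_simps)
  then show ?thesis by simp
qed

text \<open>The slope is \<open>3 / 4 * (1 - 0.6932)\<close>, just below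
  \<open>3 / 4 * (1 - ln 2)\<close>, the integral of the asymptotic bound over
  \<open>2 \<le> u \<le> 4\<close>.\<close>

lemma second_half_even:
  fixes s m :: real
  assumes "11 \<le> s" "m = 2 * s + 2"
  shows "2301/10000 * s - 1/100 \<le>
    s * (s - 1) / (m * (m - 1)) * (1 + (m - s) * (m - s + 1) / (m * (s + 1))) * (m - 1) *
    (2 * m * m / ((m - 1) * (2 * m - 1)) - (6932/10000 + 3 / (4 * m - 6)))" (is "?l \<le> ?r")
proof -
  obtain t where t: "s = t + 11" "0 \<le> t"
    using assms(1) by (metis add.commute le_add_diff_inverse diff_ge_0_iff_ge)
  have "0 \<le> ?r - ?l"
    unfolding assms(2) t(1) using t(2) by (simp add: divide_simps) (simp add: algebra_simps)
  then show ?thesis by simp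
qed

lemma second_half_odd:
  fixes s m :: real
  assumes "11 \<le> s" "m = 2 * s + 3"
  shows "2301/10000 * s - 1/100 \<le>
    s * (s - 1) / (m * (m - 1)) * (1 + (m - s) * (m - s + 1) / (m * (s + 1))) * (m - 1) *
    (2 * m * m / ((m - 1) * (2 * m - 1)) - (6932/10000 + 3 / (4 * m - 6)))" (is "?l \<le> ?r")
proof -
  obtain t where t: "s = t + 11" "0 \<le> t"
    using assms(1) by (metis add.commute le_add_diff_inverse diff_ge_0_iff_ge)
  have "0 \<le> ?r - ?l"
    unfolding assms(2) t(1) using t(2) by (simp add: divide_simps) (simp add: algebra_simps)
  then show ?thesis by simp
qed

text \<open>
  Here and below \<open>s\<close> is the number of exploration steps; \<open>s + 1\<close> replaces the asymptotically equal \<open>s\<close>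
  to leave room for lower-order terms.
\<close>

definition low1_bound :: "real \<Rightarrow> real \<Rightarrow> real \<Rightarrow> real" where
  "low1_bound s m k = s * (s - 1) / (k * (k - 1)) * (1 + (k - s) * (2 * m - k - s + 1) / (m * (s + 1)))"

text \<open>Partial fractions in \<open>k\<close>: a telescoping part, a harmonic part and a
  constant, each of which can be summed over \<open>k\<close>.\<close>

lemma low1_bound_split:
  fixes s m k :: real
  assumes "1 < k" "0 < m" "0 < s"
  shows "low1_bound s m k = s * (s - 1) * (1 + (2 * m - s * (2 * m + 1 - s)) / (m * (s + 1))) * (1 / (k * (k - 1)))
    + s * (s - 1) / (m * (s + 1)) * (2 * m * (1 / k) - 1)"
proof -
  define D where "D = m * (s + 1)"
  have "0 < D" unfolding D_def using assms by (intro mult_pos_pos) auto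
  then have "D \<noteq> 0" by simp
  then show ?thesis
    unfolding low1_bound_def D_def[symmetric] using assms(1)
    by (simp add: divide_simps) (simp add: algebra_simps)
qed

lemma first_half_sum:
  fixes s m :: nat
  assumes s: "11 \<le> s" and m: "m = 2 * s + 2 \<or> m = 2 * s + 3"
  shows "6362/10000 * real s + (if m = 2 * s + 2 then 101/100 else 145/100) \<le>
    (\<Sum>k=s..<m. low1_bound s m k)"
proof -
  define H where "H = (\<Sum>k=s..<m. 1 / real k)"
  define a where "a = 1 + (2 * real m - real s * (2 * real m + 1 - real s)) / (real m * (real s + 1))"
  let ?r = "if m = 2 * s + 2 then 2 / (2 * real s + 1) else 6 / (4 * real s + 3)"
  let ?H = "6931/10000 + ?r + (1 / real s - 1 / real m) / 2"
  have sm: "0 < s" "s \<le> m" "1 < s" using s m by auto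
  have "(\<Sum>k=s..<m. low1_bound s m k) = (\<Sum>k=s..<m. real s * (real s - 1) * a * (1 / (real k * (real k - 1)))
    + real s * (real s - 1) / (real m * (real s + 1)) * (2 * real m * (1 / real k) - 1))"
    using s sm by (intro sum.cong refl) (subst low1_bound_split, auto simp: a_def)
  also have "\<dots> = real s * (real s - 1) * a * (1 / (real s - 1) - 1 / (real m - 1)) +
      real s * (real s - 1) / (real m * (real s + 1)) * (2 * real m * H - (real m - real s))"
    using sm by (simp only: sum.distrib sum_distrib_left[symmetric] sum_subtractf H_def
        sum_inverse_consecutive[OF sm(3,2)]) (simp add: of_nat_diff)
  also have "real s * (real s - 1) * a * (1 / (real s - 1) - 1 / (real m - 1)) =
      real s * a * ((real m - real s) / (real m - 1))"
    using sm by (simp add: divide_simps)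
  finally have sum: "(\<Sum>k=s..<m. low1_bound s m k) =
      real s * a * ((real m - real s) / (real m - 1)) +
      real s * (real s - 1) / (real m * (real s + 1)) * (2 * real m * H - (real m - real s))" .
  \<comment> \<open>Because of rounding \<open>m / s\<close> is slightly more than \<open>2\<close>;
    \<open>?r\<close> bounds the resulting gain \<open>ln (m / (2 * s))\<close> from below.\<close>
  have "?r \<le> ln (real m) - ln 2 - ln (real s)"
    using m
  proof
    assume m: "m = 2 * s + 2"
    have "2 / (2 * real s + 1) \<le> ln (1 + 1 / real s)"
      using ln_quotient_ge[of "1 / real s"] sm by (simp add: field_simps)
    moreover have "real m = 2 * real s * (1 + 1 / real s)" using sm by (simp add: m field_simps)
    moreover have "0 < 1 + 1 / real s" using sm by (simp add: add_pos_pos)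
    ultimately have "ln (real m) = ln 2 + ln (real s) + ln (1 + 1 / real s)"
      using sm by (simp only: ln_mult_pos mult_pos_pos zero_less_numeral of_nat_0_less_iff)
    then show ?thesis using m \<open>_ \<le> ln (1 + 1 / real s)\<close> by simp
  next
    assume m: "m = 2 * s + 3"
    have "6 / (4 * real s + 3) \<le> ln (1 + 3 / (2 * real s))"
      using ln_quotient_ge[of "3 / (2 * real s)"] sm by (simp add: field_simps)
    moreover have "real m = 2 * real s * (1 + 3 / (2 * real s))" using sm by (simp add: m field_simps)
    moreover have "0 < 1 + 3 / (2 * real s)" using sm by (simp add: add_pos_pos)
    ultimately have "ln (real m) = ln 2 + ln (real s) + ln (1 + 3 / (2 * real s))"
      using sm by (simp only: ln_mult_pos mult_pos_pos zero_less_numeral of_nat_0_less_iff)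
    then show ?thesis using m \<open>_ \<le> ln (1 + 3 / (2 * real s))\<close> by simp
  qed
  then have "?H \<le> H"
    using sum_inverse_ge[OF sm(1,2)] ln_2_bounds(1) unfolding H_def by linarith
  then have "real s * (real s - 1) / (real m * (real s + 1)) * (2 * real m * ?H - (real m - real s))
    \<le> real s * (real s - 1) / (real m * (real s + 1)) * (2 * real m * H - (real m - real s))"
    using sm by (intro mult_left_mono diff_right_mono) auto
  moreover have "6362/10000 * real s + (if m = 2 * s + 2 then 101/100 else 145/100) \<le>
      real s * a * ((real m - real s) / (real m - 1)) +
      real s * (real s - 1) / (real m * (real s + 1)) * (2 * real m * ?H - (real m - real s))"
  proof (cases "m = 2 * s + 2")
    case True
    then have "real m = 2 * real s + 2" by simp
    from first_half_even[OF _ this] s show ?thesis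
      by (simp only: if_P[OF True] a_def times_divide_eq_left numeral_le_real_of_nat_iff)
  next
    case False
    then have "real m = 2 * real s + 3" using m by simp
    from first_half_odd[OF _ this] s show ?thesis
      by (simp only: if_not_P[OF False] a_def times_divide_eq_left numeral_le_real_of_nat_iff)
  qed
  ultimately show ?thesis unfolding sum by linarith
qed

lemma second_half_sum:
  fixes s m :: nat
  assumes s: "11 \<le> s" and m: "m = 2 * s + 2 \<or> m = 2 * s + 3"
  shows "2301/10000 * real s - 1/100 \<le>
    (\<Sum>k=m..<2*m. low1_bound s m m * (real m - 1) * ((2 * real m - real k) / (real k * (real k - 1))))"
proof -
  have m2: "1 < m" "m \<le> 2 * m" using m s by auto
  define H where "H = (\<Sum>k=m..<2*m. 1 / (real k - 1))"
  have "(\<Sum>k=m..<2*m. (2 * real m - real k) / (real k * (real k - 1))) =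
      (\<Sum>k=m..<2*m. 2 * real m * (1 / (real k * (real k - 1))) - 1 / (real k - 1))"
  proof (intro sum.cong refl)
    fix k assume "k \<in> {m..<2*m}"
    then have "real k \<noteq> 0" "real k - 1 \<noteq> 0" using m2 by auto
    then show "(2 * real m - real k) / (real k * (real k - 1)) =
        2 * real m * (1 / (real k * (real k - 1))) - 1 / (real k - 1)"
      by (simp add: diff_divide_distrib)
  qed
  also have "\<dots> = 2 * real m * (1 / (real m - 1) - 1 / (real (2 * m) - 1)) - H"
    unfolding H_def by (simp only: sum_subtractf sum_distrib_left[symmetric]
        sum_inverse_consecutive[OF m2])
  also have "\<dots> = 2 * real m * real m / ((real m - 1) * (2 * real m - 1)) - H"
    using m2 by (simp add: divide_simps)
  finally have sum: "(\<Sum>k=m..<2*m. (2 * real m - real k) / (real k * (real k - 1))) =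
    2 * real m * real m / ((real m - 1) * (2 * real m - 1)) - H" .
  have pos: "0 < 2 * real m - 3" "0 < 1 + 3 / (4 * real m - 6)"
    using m s by (auto intro!: add_pos_nonneg)
  have "H = (\<Sum>k=m-1..<2*m-1. 1 / real k)"
    unfolding H_def using m2
    by (intro sum.reindex_bij_witness[of _ Suc "\<lambda>k. k - 1"]) (auto simp: of_nat_diff)
  also have "\<dots> \<le> ln (2 * real (2 * m - 1) - 1) - ln (2 * real (m - 1) - 1)"
    using m2 by (intro sum_inverse_le) auto
  also have "\<dots> = ln (4 * real m - 3) - ln (2 * real m - 3)"
    using m2 by (simp add: of_nat_diff algebra_simps)
  \<comment> \<open>The factorisation separates \<open>ln 2\<close> from a correction of order
    \<open>1 / m\<close>.\<close>
  also have "4 * real m - 3 = 2 * (2 * real m - 3) * (1 + 3 / (4 * real m - 6))"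
    using m s by (auto simp: field_simps)
  also have "ln \<dots> = ln 2 + ln (2 * real m - 3) + ln (1 + 3 / (4 * real m - 6))"
    by (simp only: ln_mult_pos mult_pos_pos zero_less_numeral pos)
  also have "ln (1 + 3 / (4 * real m - 6)) \<le> 3 / (4 * real m - 6)"
    using m s by (intro ln_add_one_self_le_self) auto
  finally have H: "H \<le> 6932/10000 + 3 / (4 * real m - 6)" using ln_2_bounds(2) by linarith
  have "2301/10000 * real s - 1/100 \<le> low1_bound s m m * (real m - 1) *
      (2 * real m * real m / ((real m - 1) * (2 * real m - 1)) - (6932/10000 + 3 / (4 * real m - 6)))"
  proof -
    have eq: "low1_bound s m m = real s * (real s - 1) / (real m * (real m - 1)) *
        (1 + (real m - real s) * (real m - real s + 1) / (real m * (real s + 1)))"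
      by (simp add: low1_bound_def)
    show ?thesis
    proof (cases "m = 2 * s + 2")
      case True
      then have "real m = 2 * real s + 2" by simp
      from second_half_even[OF _ this] s show ?thesis unfolding eq by simp
    next
      case False
      then have "real m = 2 * real s + 3" using m by simp
      from second_half_odd[OF _ this] s show ?thesis unfolding eq by simp
    qed
  qed
  also have "\<dots> \<le> low1_bound s m m * (real m - 1) *
      (2 * real m * real m / ((real m - 1) * (2 * real m - 1)) - H)"
    using H m s by (intro mult_left_mono diff_left_mono mult_nonneg_nonneg)
      (auto simp: low1_bound_def)
  finally show ?thesis unfolding sum_distrib_left[symmetric] sum .
qed

text \<open>This is the solution \<open>f01\<close> of the joint recursion below, divided by the
  homogeneous solution \<open>fall4 s k * (m - k) / m\<close>. The summand for \<open>i\<close>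
  comes from an arrival whose partner is the second vertex while both vertices are still
  unmatched.\<close>

definition eta :: "nat \<Rightarrow> nat \<Rightarrow> nat \<Rightarrow> real" where
  "eta s m k = 1 + (\<Sum>i=s..<k. 2 * (real m - real i) / ((real i - 3) * (real m - 1)))"

lemma eta_ge_one:
  assumes "11 \<le> s" "k \<le> m"
  shows "1 \<le> eta s m k"
  using assms by (auto simp: eta_def intro!: sum_nonneg)

text \<open>
  Asymptotically \<open>eta\<close> and the cubic \<open>u\<^sup>2 * (2 - u)\<close> touch to second order at \<open>u = 1\<close>. The increments are
  therefore compared with a cubic that is scaled down by \<open>(s + 3) / (s + 5)\<close>, and the slack gained at
  the starting point pays for the difference.
\<close>

lemma eta_ge:
  assumes s: "11 \<le> s" and m: "m = 2 * s + 2 \<or> m = 2 * s + 3" and k: "s \<le> k" "k < m"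
  shows "(real k - 2) * (real k - 3) * (real m - real k - 1) \<le>
    eta s m k * ((real s + 3) * (real s - 2) * (real s - 3))"
proof -
  define c where "c = (real s + 5) * (real s - 2) * (real s - 3)"
  define e where "e k = (real k - 2) * (real k - 3) * (real m - real k - 1) / c" for k
  have c: "0 < c" using s by (simp add: c_def)
  \<comment> \<open>Since \<open>eta\<close> starts at \<open>1\<close>, it suffices to compare
    increments; \<open>eta_step_ineq\<close> is used with \<open>s + i = k + 1\<close>.\<close>
  have "1 + e k - e s \<le> eta s m k"
    using k
  proof (induction k rule: dec_induct)
    case base
    then show ?case by (simp add: eta_def)
  next
    case (step k)
    have x: "11 \<le> real k" "0 < real m - 1" using step s by auto
    have "(real s + (real k + 1 - real s) - 3) * (real s + (real k + 1 - real s) - 4) *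
        (2 * real m - 3 * (real s + (real k + 1 - real s)) + 2) * (real m - 1)
        \<le> 2 * (real m - (real s + (real k + 1 - real s)) + 1) * (real s + 5) * (real s - 2) * (real s - 3)"
      using s m step by (intro eta_step_ineq) auto
    then have "(real k - 2) * (2 * real m - 3 * real k - 1) * ((real k - 3) * (real m - 1))
        \<le> 2 * (real m - real k) * c"
      by (simp add: c_def algebra_simps)
    then have "(real k - 2) * (2 * real m - 3 * real k - 1) / c \<le>
        2 * (real m - real k) / ((real k - 3) * (real m - 1))"
      using c x by (simp add: divide_le_eq pos_le_divide_eq mult_ac)
    moreover have "e (Suc k) - e k = (real k - 2) * (2 * real m - 3 * real k - 1) / c"
      unfolding e_def diff_divide_distrib[symmetric] by (simp add: algebra_simps)
    ultimately have "e (Suc k) - e k \<le> 2 * (real m - real k) / ((real k - 3) * (real m - 1))" by simp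
    moreover have "eta s m (Suc k) = eta s m k + 2 * (real m - real k) / ((real k - 3) * (real m - 1))"
      using step by (simp add: eta_def)
    ultimately show ?case using step by simp
  qed
  \<comment> \<open>The factor \<open>1 + 2 / (s + 3) = (s + 5) / (s + 3)\<close> undoes the scaling
    of the cubic. The extra term has to fit into the slack \<open>1 - e s\<close>, which is at least
    \<open>3 / (s + 5)\<close>.\<close>
  moreover have "e k * (2 / (real s + 3)) \<le> 1 - e s"
  proof -
    define N where "N = (real k - 2) * (real k - 3) * (real m - real k - 1)"
    define K where "K = (real s + 3) * (real s - 2) * (real s - 3)"
    have "0 < K" using s by (simp add: K_def)
    moreover have "2 * N \<le> 3 * K"
      unfolding N_def K_def using s m k by (intro cubic_bound) auto
    ultimately have "2 * N / K / (real s + 5) \<le> 3 / (real s + 5)"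
      by (intro divide_right_mono) (auto simp: divide_le_eq)
    moreover have "e k * (2 / (real s + 3)) = 2 * N / K / (real s + 5)"
      by (simp add: e_def c_def N_def K_def mult_ac)
    ultimately have "e k * (2 / (real s + 3)) \<le> 3 / (real s + 5)" by simp
    moreover have "e s = (real m - real s - 1) / (real s + 5)"
      using s by (simp add: e_def c_def)
    moreover have "3 / (real s + 5) \<le> 1 - (real m - real s - 1) / (real s + 5)"
      using s m by (auto simp: divide_simps)
    ultimately show ?thesis by linarith
  qed
  ultimately have "e k * (1 + 2 / (real s + 3)) \<le> eta s m k" by (simp add: distrib_left)
  moreover have "e k * (1 + 2 / (real s + 3)) =
      (real k - 2) * (real k - 3) * (real m - real k - 1) / ((real s + 3) * (real s - 2) * (real s - 3))"
  proof -
    have "1 + 2 / (real s + 3) = (real s + 5) / (real s + 3)" using s by (simp add: field_simps)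
    then show ?thesis using s by (simp add: e_def c_def mult_ac)
  qed
  ultimately show ?thesis using s by (simp add: divide_le_eq mult_ac)
qed

text \<open>For integers \<open>s \<le> x\<close> this is the product of \<open>1 - 2 / i\<close>
  over \<open>s < i \<le> x\<close> in closed form. Likewise \<open>fall4\<close> is the product of
  \<open>1 - 4 / i\<close>.\<close>

definition fall2 :: "real \<Rightarrow> real \<Rightarrow> real" where
  "fall2 s x = s * (s - 1) / (x * (x - 1))"

definition fall4 :: "real \<Rightarrow> real \<Rightarrow> real" where
  "fall4 s x = s * (s - 1) * (s - 2) * (s - 3) / (x * (x - 1) * (x - 2) * (x - 3))"

lemma fall2_Suc: "1 < x \<Longrightarrow> fall2 s (x + 1) = (1 - 2 / (x + 1)) * fall2 s x"
  by (simp add: fall2_def divide_simps)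

lemma fall4_Suc: "3 < x \<Longrightarrow> fall4 s (x + 1) = (1 - 4 / (x + 1)) * fall4 s x"
  by (simp add: fall4_def divide_simps)

lemma fall4_eq: "3 < x \<Longrightarrow> fall4 s x * ((x - 2) * (x - 3)) = fall2 s x * ((s - 2) * (s - 3))"
  by (simp add: fall2_def fall4_def divide_simps)

lemma fall_nonneg: "1 \<le> s \<Longrightarrow> 1 < x \<Longrightarrow> 0 \<le> fall2 s x" "3 \<le> s \<Longrightarrow> 3 < x \<Longrightarrow> 0 \<le> fall4 s x"
  by (auto simp: fall2_def fall4_def)

lemma low1_bound_eq:
  "low1_bound s m x = fall2 s x * (1 + (x - s) * (2 * m - x - s + 1) / (m * (s + 1)))"
  by (simp add: low1_bound_def fall2_def)

lemma mult_one_minus_divide: "z \<noteq> 0 \<Longrightarrow> z * (1 - c / z) = z - c" for c z :: real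
  by (simp add: right_diff_distrib)

text \<open>
  For small \<open>n\<close> the rounding in \<open>n div 4\<close> spoils the closed forms, but there the plain recursion for
  (unmatched, free place), which treats every random choice as if it were forced, suffices. The third
  component sums the second one over the exploitation phase.
\<close>

primrec small_run :: "nat \<Rightarrow> nat \<Rightarrow> nat \<Rightarrow> real \<times> real \<times> real" where
  "small_run m q 0 = (1, 1, 0)"
| "small_run m q (Suc k) = (case small_run m q k of (f, b, S) \<Rightarrow>
     (if Suc k < q then f * (1 - 1 / (real m - real k))
      else if k < m then max 0 ((1 - 2 / real (Suc k)) * (f * (1 - 1 / (real m - real k)))) else 0,
      if Suc k < q then b
      else if k < m then 2 / real (Suc k) * f + (1 - 2 / real (Suc k)) * b
      else (1 - 2 / real (Suc k)) * (b * (1 - 1 / (2 * real m - real k))),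
      S + of_bool (q \<le> Suc k) * b))"

text \<open>This form lets the simplifier evaluate the recursion directly at numerals.\<close>

lemma small_run_numeral:
  "small_run m q (numeral v) = (case small_run m q (pred_numeral v) of (f, b, S) \<Rightarrow>
     (if numeral v < q then f * (1 - 1 / (real m - real (pred_numeral v)))
      else if pred_numeral v < m
        then max 0 ((1 - 2 / numeral v) * (f * (1 - 1 / (real m - real (pred_numeral v))))) else 0,
      if numeral v < q then b
      else if pred_numeral v < m then 2 / numeral v * f + (1 - 2 / numeral v) * b
      else (1 - 2 / numeral v) * (b * (1 - 1 / (2 * real m - real (pred_numeral v)))),
      S + of_bool (q \<le> numeral v) * b))"
proof -
  have Suc: "numeral v = Suc (pred_numeral v)" by (simp add: numeral_eq_Suc)
  then have "(numeral v :: real) = real (Suc (pred_numeral v))" by (metis of_nat_numeral)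
  then show ?thesis by (simp only: Suc small_run.simps)
qed

lemma small_run_sum:
  assumes "m \<le> 23"
  shows "50 / 231 * (2 * real m) \<le> snd (snd (small_run m (2 * m div 4) (2 * m)))"
proof -
  have "m = 0 \<or> m = 1 \<or> m = 2 \<or> m = 3 \<or> m = 4 \<or> m = 5 \<or> m = 6 \<or> m = 7 \<or> m = 8 \<or> m = 9 \<or> m = 10 \<or> m = 11 \<or> m = 12 \<or> m = 13 \<or> m = 14 \<or> m = 15 \<or> m = 16 \<or> m = 17 \<or> m = 18 \<or> m = 19 \<or> m = 20 \<or> m = 21 \<or> m = 22 \<or> m = 23"
    using assms by presburger
  then show ?thesis by (elim disjE) (simp_all add: small_run_numeral)
qed

section \<open>The algorithm on a uniformly random arrival order\<close>

lemma expectation_bind_finite: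
  fixes h :: "'b \<Rightarrow> real"
  assumes "finite (set_pmf p)" "\<And>x. x \<in> set_pmf p \<Longrightarrow> finite (set_pmf (f x))"
  shows "measure_pmf.expectation (p \<bind> f) h =
           measure_pmf.expectation p (\<lambda>x. measure_pmf.expectation (f x) h)"
  using assms
  by (subst pmf_expectation_bind[of "set_pmf p"]) (auto simp: integral_measure_pmf[of "set_pmf p"])

lemma expectation_mono_finite:
  fixes g h :: "'a \<Rightarrow> real"
  assumes "finite (set_pmf p)" "\<And>x. x \<in> set_pmf p \<Longrightarrow> g x \<le> h x"
  shows "measure_pmf.expectation p g \<le> measure_pmf.expectation p h"
  using assms
  by (intro integral_mono_AE) (auto simp: integrable_measure_pmf_finite AE_measure_pmf_iff)

text \<open>The permutations are split by their head, which is the last arrival in the reversed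
  lists used for \<open>run\<close>.\<close>

lemma sum_permutations_of_set:
  assumes "finite T" "T \<noteq> {}"
  shows "(\<Sum>xs\<in>permutations_of_set T. f xs) =
    (\<Sum>r\<in>T. \<Sum>ys\<in>permutations_of_set (T - {r}). f (r # ys))"
proof -
  have "(\<Sum>xs\<in>permutations_of_set T. f xs) =
      (\<Sum>xs\<in>(\<Union>r\<in>T. (#) r ` permutations_of_set (T - {r})). f xs)"
    by (simp only: permutations_of_set_nonempty[OF assms(2)])
  also have "\<dots> = (\<Sum>r\<in>T. \<Sum>xs\<in>(#) r ` permutations_of_set (T - {r}). f xs)"
    using assms(1) by (intro sum.UNION_disjoint) auto
  also have "\<dots> = (\<Sum>r\<in>T. \<Sum>ys\<in>permutations_of_set (T - {r}). f (r # ys))"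
    by (rule sum.cong[OF refl]) (subst sum.reindex, auto)
  finally show ?thesis .
qed

section \<open>Degrees, available vertices and the state invariant\<close>

locale matching_instance =
  fixes L :: "'l set" and R :: "'r set" and n m :: nat
    and w :: "'l \<Rightarrow> 'r \<Rightarrow> real" and opt :: "'r set \<Rightarrow> ('l, 'r) matching"
  assumes finite_L: "finite L" and finite_R: "finite R"
    and card_R: "card R = n" and n_eq: "n = 2 * m" and card_L: "card L = m"
    and w_nonneg: "\<And>l r. l \<in> L \<Longrightarrow> r \<in> R \<Longrightarrow> w l r \<ge> 0"
    and opt_max: "\<And>T. T \<subseteq> R \<Longrightarrow> is_max_matching L T w (opt T)"
begin

definition deg :: "('l, 'r) matching \<Rightarrow> 'l \<Rightarrow> nat" where
  "deg M l = card {r. (l, r) \<in> M}"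

definition avail :: "('l, 'r) matching \<Rightarrow> 'l set" where
  "avail M = (if \<exists>l\<in>L. deg M l = 0 then {l\<in>L. deg M l = 0} else {l\<in>L. deg M l < 2})"

definition valid :: "'r set \<Rightarrow> ('l, 'r) matching \<Rightarrow> bool" where
  "valid T M \<longleftrightarrow> M \<subseteq> L \<times> T \<and> (\<forall>r\<in>T. \<exists>!l. (l, r) \<in> M) \<and> (\<forall>l\<in>L. deg M l \<le> 2)"

definition partner :: "'r set \<Rightarrow> 'r \<Rightarrow> 'l" where
  "partner T r = (THE l. (l, r) \<in> opt T)"

text \<open>The arrival order is stored in reverse: the head of the list is the last arrival.\<close>

primrec run :: "'r list \<Rightarrow> ('l, 'r) alg_state pmf" where
  "run [] = return_pmf ({}, L)"
| "run (r # ys) = bind_pmf (run ys)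
     (alg2_step L opt n (Suc (length ys)) (insert r (set ys)) r)"

lemma alg2_state_eq_run:
  assumes "length xs = n" "v \<le> n"
  shows "alg2_state L opt xs v = run (rev (take v xs))"
  using assms(2)
proof (induction v)
  case (Suc v)
  have "rev (take (Suc v) xs) = xs ! v # rev (take v xs)"
    using Suc assms(1) by (simp add: take_Suc_conv_app_nth)
  moreover have "length (rev (take v xs)) = v"
    using Suc assms(1) by simp
  ultimately show ?case
    using Suc assms(1) by (simp add: take_Suc_conv_app_nth)
qed simp

lemma finite_valid: "valid T M \<Longrightarrow> T \<subseteq> R \<Longrightarrow> finite M"
  using finite_L finite_R by (intro finite_subset[of M "L \<times> R"]) (auto simp: valid_def)

lemma finite_avail: "finite (avail M)"
  using finite_L by (simp add: avail_def)

lemma avail_subset: "avail M \<subseteq> L"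
  by (auto simp: avail_def)

lemma deg_insert:
  assumes "valid T M" "T \<subseteq> R" "r \<notin> T"
  shows "deg (insert (x, r) M) l = deg M l + of_bool (x = l)"
proof (cases "x = l")
  case True
  have "{r'. (l, r') \<in> insert (x, r) M} = insert r {r'. (l, r') \<in> M}"
    using True by auto
  moreover have "finite {r'. (l, r') \<in> M}"
    using assms finite_R by (intro finite_subset[of "{r'. (l, r') \<in> M}" R]) (auto simp: valid_def)
  moreover have "(l, r) \<notin> M" using assms by (auto simp: valid_def)
  ultimately show ?thesis using True by (simp add: deg_def)
next
  case False
  then show ?thesis by (auto simp: deg_def intro!: arg_cong[of _ _ card])
qed

lemma valid_insert:
  assumes "valid T M" "T \<subseteq> R" "r \<notin> T" "x \<in> L" "deg M x < 2"
  shows "valid (insert r T) (insert (x, r) M)"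
proof -
  have "\<exists>!l. (l, r') \<in> insert (x, r) M" if "r' \<in> insert r T" for r'
  proof (cases "r' = r")
    case True
    have "(l, r) \<notin> M" for l using assms by (auto simp: valid_def)
    then show ?thesis using True by auto
  next
    case False
    then show ?thesis using that assms(1) by (auto simp: valid_def)
  qed
  moreover have "deg (insert (x, r) M) l \<le> 2" if "l \<in> L" for l
  proof -
    have "deg M l \<le> 2" using that assms(1) by (simp add: valid_def)
    then show ?thesis unfolding deg_insert[OF assms(1-3)] using assms(5) by auto
  qed
  ultimately show ?thesis using assms(1,4) by (auto simp: valid_def)
qed

lemma sum_deg:
  assumes "valid T M" "T \<subseteq> R"
  shows "(\<Sum>l\<in>L. deg M l) = card T"
proof -
  have fT: "finite T" using assms(2) finite_R finite_subset by blast
  have "(\<Sum>l\<in>L. deg M l) = (\<Sum>l\<in>L. \<Sum>r\<in>T. of_bool ((l, r) \<in> M))"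
  proof (intro sum.cong refl)
    fix l assume "l \<in> L"
    have "{r. (l, r) \<in> M} = {r \<in> T. (l, r) \<in> M}" using assms(1) by (auto simp: valid_def)
    then show "deg M l = (\<Sum>r\<in>T. of_bool ((l, r) \<in> M))"
      using fT by (simp add: deg_def of_bool_def sum.If_cases Int_def)
  qed
  also have "\<dots> = (\<Sum>r\<in>T. \<Sum>l\<in>L. of_bool ((l, r) \<in> M))" by (rule sum.swap)
  also have "\<dots> = (\<Sum>r\<in>T. 1)"
  proof (intro sum.cong refl)
    fix r assume "r \<in> T"
    then have "\<exists>!l. (l, r) \<in> M" using assms(1) by (simp add: valid_def)
    then obtain l where l: "(l, r) \<in> M" "\<And>l'. (l', r) \<in> M \<Longrightarrow> l' = l" by blast
    have "l \<in> L" using l(1) assms(1) unfolding valid_def by blast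
    have "(l', r) \<in> M \<longleftrightarrow> l' = l" for l' using l(1) l(2)[of l'] by blast
    then have "(\<Sum>l'\<in>L. of_bool ((l', r) \<in> M)) = (\<Sum>l'\<in>L. if l' = l then 1 else 0 :: nat)"
      by (simp add: of_bool_def)
    then show "(\<Sum>l\<in>L. of_bool ((l, r) \<in> M)) = (1::nat)"
      using finite_L \<open>l \<in> L\<close> by simp
  qed
  finally show ?thesis by simp
qed

text \<open>Each matched vertex uses up at least one of the \<open>card T\<close> edges.\<close>

lemma card_unmatched_ge:
  assumes "valid T M" "T \<subseteq> R"
  shows "m - card T \<le> card {l\<in>L. deg M l = 0}"
proof -
  have "card {l\<in>L. deg M l \<noteq> 0} \<le> (\<Sum>l\<in>{l\<in>L. deg M l \<noteq> 0}. deg M l)"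
    using finite_L by (subst card_eq_sum, intro sum_mono) (simp add: Suc_leI)
  also have "\<dots> \<le> card T"
    using finite_L by (subst sum_deg[OF assms, symmetric]) (auto intro: sum_mono2)
  finally have "card {l\<in>L. deg M l \<noteq> 0} \<le> card T" .
  moreover have "card L = card {l\<in>L. deg M l = 0} + card {l\<in>L. deg M l \<noteq> 0}"
    using finite_L by (subst card_Un_disjoint[symmetric]) (auto intro!: arg_cong[of _ _ card])
  ultimately show ?thesis using card_L by simp
qed

text \<open>All degrees are \<open>1\<close> or \<open>2\<close>, so \<open>deg M l\<close> plus the
  indicator of \<open>deg M l < 2\<close> is always \<open>2\<close>. Summation over
  \<open>L\<close> gives \<open>2 * m = n\<close>.\<close>

lemma card_avail_late:
  assumes "valid T M" "T \<subseteq> R" "\<not> (\<exists>l\<in>L. deg M l = 0)"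
  shows "card (avail M) + card T = n"
proof -
  have "(\<Sum>l\<in>L. deg M l + of_bool (deg M l < 2)) = (\<Sum>l\<in>L. 2)"
    using assms(1,3) by (intro sum.cong) (auto simp: valid_def of_bool_def le_less_Suc_eq numeral_2_eq_2)
  moreover have "avail M = {l\<in>L. deg M l < 2}"
    using assms(3) unfolding avail_def by (rule if_not_P)
  then have "(\<Sum>l\<in>L. of_bool (deg M l < 2)) = card (avail M)"
    using finite_L by (simp add: of_bool_def sum.If_cases Int_def)
  ultimately show ?thesis
    using sum_deg[OF assms(1,2)] card_L n_eq by (simp add: sum.distrib)
qed

lemma avail_early:
  assumes "valid T M" "T \<subseteq> R" "card T < m"
  shows "\<exists>l\<in>L. deg M l = 0" "m - card T \<le> card (avail M)"
proof -
  have "{l\<in>L. deg M l = 0} \<noteq> {}"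
    using card_unmatched_ge[OF assms(1,2)] assms(3) by (metis card.empty not_le zero_less_diff)
  then show *: "\<exists>l\<in>L. deg M l = 0" by blast
  show "m - card T \<le> card (avail M)"
    using card_unmatched_ge[OF assms(1,2)] * by (simp add: avail_def)
qed

lemma avail_nonempty:
  assumes "valid T M" "T \<subseteq> R" "card T < n"
  shows "avail M \<noteq> {}"
proof (cases "\<exists>l\<in>L. deg M l = 0")
  case True
  then show ?thesis by (auto simp: avail_def)
next
  case False
  then show ?thesis using card_avail_late[OF assms(1,2)] assms(3) by auto
qed

lemma avail_zero:
  "{l\<in>L. deg M l = 0} \<noteq> {} \<Longrightarrow> avail M = {l\<in>L. deg M l = 0}"
  unfolding avail_def by (rule if_P) blast

lemma avail_nonzero:
  "{l\<in>L. deg M l = 0} = {} \<Longrightarrow> avail M = {l\<in>L. deg M l < 2}"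
  unfolding avail_def by (rule if_not_P) blast

text \<open>This keeps the stored available set a function of the matching alone. The vertex
  \<open>x\<close> need not be available: a partner of degree one may be used while unmatched
  vertices remain, and then nothing is removed. Once no vertex is unmatched, \<open>x\<close> had
  degree one, and its removal corresponds to its becoming full.\<close>

lemma reset_insert:
  assumes "valid T M" "T \<subseteq> R" "r \<notin> T" "x \<in> L" "deg M x < 2"
  shows "reset_available L (insert (x, r) M, avail M - {x}) =
    (insert (x, r) M, avail (insert (x, r) M))"
proof (cases "{l\<in>L. deg M l = 0} = {}")
  case False
  let ?Z = "{l\<in>L. deg (insert (x, r) M) l = 0}"
  have Z: "avail M - {x} = ?Z"
    unfolding deg_insert[OF assms(1-3)] avail_zero[OF False] by auto
  show ?thesis
  proof (cases "?Z = {}")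
    case True
    show ?thesis
      unfolding reset_available_def prod.case deg_def[symmetric] Z avail_nonzero[OF True] by (rule if_P[OF True])
  next
    case False
    show ?thesis
      unfolding reset_available_def prod.case deg_def[symmetric] Z avail_zero[OF False] by (rule if_not_P[OF False])
  qed
next
  case True
  let ?A = "{l\<in>L. deg (insert (x, r) M) l < 2}"
  have pos: "0 < deg M l" if "l \<in> L" for l
  proof (rule ccontr)
    assume "\<not> 0 < deg M l"
    then have "l \<in> {l\<in>L. deg M l = 0}" using that by simp
    then show False unfolding True by simp
  qed
  have x: "deg M x = 1" using assms(5) pos[OF assms(4)] by simp
  have A: "avail M - {x} = ?A"
    unfolding deg_insert[OF assms(1-3)] avail_nonzero[OF True]
    using x by (simp add: set_eq_iff of_bool_def)
  have "avail (insert (x, r) M) = ?A"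
    by (rule avail_nonzero) (unfold deg_insert[OF assms(1-3)], simp add: pos)
  then show ?thesis
    unfolding reset_available_def prod.case deg_def[symmetric] A by (simp only: if_cancel)
qed

lemma partner:
  assumes "T \<subseteq> R" "r \<in> T"
  shows "(l, r) \<in> opt T \<longleftrightarrow> l = partner T r" "partner T r \<in> L"
proof -
  have o: "cap_matching L T (opt T)" "matches_all T (opt T)"
    using opt_max[OF assms(1)] by (auto simp: is_max_matching_def)
  then obtain l0 where l0: "(l0, r) \<in> opt T" using assms(2) by (auto simp: matches_all_def)
  have fin: "finite {l. (l, r) \<in> opt T}"
    using o(1) by (intro finite_subset[OF _ finite_L]) (auto simp: cap_matching_def)
  have "card {l. (l, r) \<in> opt T} \<le> 1" using o(1) assms(2) by (auto simp: cap_matching_def)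
  then have uniq: "l = l0" if "(l, r) \<in> opt T" for l
    using that l0 card_le_Suc0_iff_eq[OF fin] by simp
  have p: "partner T r = l0"
    unfolding partner_def using l0 uniq by (rule the_equality)
  show "(l, r) \<in> opt T \<longleftrightarrow> l = partner T r"
    unfolding p using l0 uniq[of l] by metis
  show "partner T r \<in> L"
    unfolding p using l0 o(1) unfolding cap_matching_def by blast
qed

lemma opt_eq:
  assumes "T \<subseteq> R"
  shows "opt T = (\<lambda>r. (partner T r, r)) ` T"
proof -
  have "opt T \<subseteq> L \<times> T" using opt_max[OF assms] by (auto simp: is_max_matching_def cap_matching_def)
  then show ?thesis using partner[OF assms] by (auto simp: image_iff)
qed

lemma card_hits:
  assumes "T \<subseteq> R" "l \<in> L"
  shows "card {r\<in>T. partner T r = l} \<le> 2"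
proof -
  have "{r\<in>T. partner T r = l} = {r. (l, r) \<in> opt T}"
    using opt_eq[OF assms(1)] by auto
  then show ?thesis
    using opt_max[OF assms(1)] assms(2) by (auto simp: is_max_matching_def cap_matching_def)
qed

text \<open>Applied to the optimal partner, this turns the validity test of the algorithm into a
  condition on a single degree.\<close>

lemma cap_matching_insert_iff:
  assumes "valid T M" "T \<subseteq> R" "r \<notin> T" "x \<in> L"
  shows "cap_matching L (insert r T) (insert (x, r) M) \<longleftrightarrow> deg M x < 2"
proof
  assume "cap_matching L (insert r T) (insert (x, r) M)"
  then have "deg (insert (x, r) M) x \<le> 2" using assms(4) by (auto simp: cap_matching_def deg_def)
  then show "deg M x < 2" using deg_insert[OF assms(1-3), of x x] by simp
next
  assume "deg M x < 2"
  from valid_insert[OF assms this] have v: "valid (insert r T) (insert (x, r) M)" .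
  have "card {l. (l, r') \<in> insert (x, r) M} \<le> 1" if "r' \<in> insert r T" for r'
  proof -
    have "\<exists>!l. (l, r') \<in> insert (x, r) M" using v that unfolding valid_def by blast
    then obtain l where
      "(l, r') \<in> insert (x, r) M" "\<And>l'. (l', r') \<in> insert (x, r) M \<Longrightarrow> l' = l" by blast
    then have "{l. (l, r') \<in> insert (x, r) M} = {l}" unfolding set_eq_iff mem_Collect_eq by blast
    then show ?thesis by simp
  qed
  then show "cap_matching L (insert r T) (insert (x, r) M)"
    using v by (auto simp: cap_matching_def valid_def deg_def)
qed

section \<open>One step as an averaging operator on functions of the matching\<close>

definition fill_mean :: "'r \<Rightarrow> (('l, 'r) matching \<Rightarrow> real) \<Rightarrow> ('l, 'r) matching \<Rightarrow> real" where
  "fill_mean r g M = (\<Sum>l\<in>avail M. g (insert (l, r) M)) / card (avail M)"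

text \<open>Here \<open>T\<close> already contains the arriving vertex \<open>r\<close>. The
  operator pulls a function of the matching after the step back to a function of the matching before
  it, with the random choice averaged out.\<close>

definition step_mean ::
  "'r set \<Rightarrow> 'r \<Rightarrow> (('l, 'r) matching \<Rightarrow> real) \<Rightarrow> ('l, 'r) matching \<Rightarrow> real" where
  "step_mean T r g M =
    (if card T < n div 4 \<or> 2 \<le> deg M (partner T r) then fill_mean r g M
     else g (insert (partner T r, r) M))"

context
  fixes T :: "'r set" and r :: 'r and M :: "('l, 'r) matching"
  assumes valid: "valid T M" and T: "insert r T \<subseteq> R" "r \<notin> T"
begin

private lemma card_T: "card T < n" "finite T"
  using T finite_R card_R
  by (metis card_mono card_insert_disjoint finite_insert finite_subset Suc_le_eq)
     (use T finite_R finite_subset in auto)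

private lemma avail_deg: "l \<in> avail M \<Longrightarrow> l \<in> L \<and> deg M l < 2"
  by (auto simp: avail_def split: if_splits)

private lemma step_eq:
  "alg2_step L opt n (Suc (card T)) (insert r T) r (M, avail M) =
    (if Suc (card T) < n div 4 \<or> 2 \<le> deg M (partner (insert r T) r)
     then map_pmf (\<lambda>l. (insert (l, r) M, avail (insert (l, r) M))) (pmf_of_set (avail M))
     else return_pmf (insert (partner (insert r T) r, r) M,
       avail (insert (partner (insert r T) r, r) M)))"
proof -
  have TR: "T \<subseteq> R" using T by auto
  have p: "partner (insert r T) r \<in> L" using partner[OF T(1)] by simp
  have ne: "avail M \<noteq> {}" using avail_nonempty[OF valid TR] card_T by simp
  have "reset_available L (insert (l, r) M, avail M - {l}) =
      (insert (l, r) M, avail (insert (l, r) M))" if "l \<in> set_pmf (pmf_of_set (avail M))" for l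
    using reset_insert[OF valid TR T(2)] avail_deg that set_pmf_of_set[OF ne finite_avail] by metis
  then have "map_pmf (reset_available L) (match_random r (M, avail M)) =
    map_pmf (\<lambda>l. (insert (l, r) M, avail (insert (l, r) M))) (pmf_of_set (avail M))"
    unfolding match_random_def prod.case map_pmf_comp by (intro map_pmf_cong refl)
  then show ?thesis
    using cap_matching_insert_iff[OF valid TR T(2) p] reset_insert[OF valid TR T(2) p]
    by (auto simp: alg2_step_def Let_def partner_def[symmetric] not_less)
qed

lemma expectation_step:
  "measure_pmf.expectation (alg2_step L opt n (Suc (card T)) (insert r T) r (M, avail M))
     (\<lambda>s. g (fst s)) = step_mean (insert r T) r g M"
proof -
  have TR: "T \<subseteq> R" using T by auto
  have "avail M \<noteq> {}" using avail_nonempty[OF valid TR] card_T by simp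
  then show ?thesis
    using card_T T by (simp add: step_eq step_mean_def fill_mean_def integral_pmf_of_set finite_avail)
qed

lemma set_pmf_step:
  assumes "s \<in> set_pmf (alg2_step L opt n (Suc (card T)) (insert r T) r (M, avail M))"
  shows "valid (insert r T) (fst s) \<and> snd s = avail (fst s)"
proof -
  have TR: "T \<subseteq> R" using T by auto
  have p: "partner (insert r T) r \<in> L" using partner[OF T(1)] by simp
  have ne: "avail M \<noteq> {}" using avail_nonempty[OF valid TR] card_T by simp
  show ?thesis
    using assms valid_insert[OF valid TR T(2)] avail_deg ne p
    by (auto simp: step_eq finite_avail not_le split: if_splits)
qed

lemma finite_set_pmf_step:
  "finite (set_pmf (alg2_step L opt n (Suc (card T)) (insert r T) r (M, avail M)))"
proof -
  have TR: "T \<subseteq> R" using T by auto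
  have "avail M \<noteq> {}" using avail_nonempty[OF valid TR] card_T by simp
  then show ?thesis by (auto simp: step_eq finite_avail)
qed

end

lemma run_valid:
  assumes "distinct ys" "set ys \<subseteq> R"
  shows "finite (set_pmf (run ys)) \<and>
    (\<forall>s\<in>set_pmf (run ys). valid (set ys) (fst s) \<and> snd s = avail (fst s))"
  using assms
proof (induction ys)
  case Nil
  have "avail {} = L" by (auto simp: avail_def deg_def)
  then show ?case by (simp add: valid_def deg_def)
next
  case (Cons r ys)
  have len: "length ys = card (set ys)" using Cons.prems by (simp add: distinct_card)
  have IH: "finite (set_pmf (run ys))"
    "\<And>s. s \<in> set_pmf (run ys) \<Longrightarrow> valid (set ys) (fst s) \<and> s = (fst s, avail (fst s))"
    using Cons by (simp_all add: prod_eq_iff)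
  have r: "insert r (set ys) \<subseteq> R" "r \<notin> set ys" using Cons.prems by auto
  have fin: "finite (set_pmf (alg2_step L opt n (Suc (card (set ys))) (insert r (set ys)) r s))"
    and ok: "\<forall>s'\<in>set_pmf (alg2_step L opt n (Suc (card (set ys))) (insert r (set ys)) r s).
      valid (insert r (set ys)) (fst s') \<and> snd s' = avail (fst s')"
    if s: "s \<in> set_pmf (run ys)" for s
  proof -
    obtain M where M: "s = (M, avail M)" "valid (set ys) M" using IH(2)[OF s] by metis
    show "finite (set_pmf (alg2_step L opt n (Suc (card (set ys))) (insert r (set ys)) r s))"
      unfolding M(1) by (rule finite_set_pmf_step[OF M(2) r])
    show "\<forall>s'\<in>set_pmf (alg2_step L opt n (Suc (card (set ys))) (insert r (set ys)) r s).
      valid (insert r (set ys)) (fst s') \<and> snd s' = avail (fst s')"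
      unfolding M(1) using set_pmf_step[OF M(2) r] by blast
  qed
  show ?case
    using IH(1) fin ok by (simp add: len set_bind_pmf)
qed

lemma expectation_run_Cons:
  assumes "distinct (r # ys)" "set (r # ys) \<subseteq> R"
  shows "measure_pmf.expectation (run (r # ys)) (\<lambda>s. g (fst s)) =
    measure_pmf.expectation (run ys) (\<lambda>s. step_mean (insert r (set ys)) r g (fst s))"
proof -
  have r: "insert r (set ys) \<subseteq> R" "r \<notin> set ys" and ys: "distinct ys" "set ys \<subseteq> R"
    using assms by auto
  have len: "length ys = card (set ys)" using assms by (simp add: distinct_card)
  have IH: "finite (set_pmf (run ys))"
    "\<And>s. s \<in> set_pmf (run ys) \<Longrightarrow> valid (set ys) (fst s) \<and> s = (fst s, avail (fst s))"
    using run_valid[OF ys] by (auto simp: prod_eq_iff)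
  let ?step = "alg2_step L opt n (Suc (card (set ys))) (insert r (set ys)) r"
  have step: "finite (set_pmf (?step s))"
    "measure_pmf.expectation (?step s) (\<lambda>s. g (fst s)) = step_mean (insert r (set ys)) r g (fst s)"
    if s: "s \<in> set_pmf (run ys)" for s
  proof -
    obtain M where M: "s = (M, avail M)" "valid (set ys) M" using IH(2)[OF s] by metis
    show "finite (set_pmf (?step s))"
      unfolding M(1) by (rule finite_set_pmf_step[OF M(2) r])
    show "measure_pmf.expectation (?step s) (\<lambda>s. g (fst s)) =
        step_mean (insert r (set ys)) r g (fst s)"
      unfolding M(1) using expectation_step[OF M(2) r] by simp
  qed
  have "measure_pmf.expectation (run (r # ys)) (\<lambda>s. g (fst s)) =
    measure_pmf.expectation (run ys) (\<lambda>s. measure_pmf.expectation (?step s) (\<lambda>s. g (fst s)))"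
    unfolding run.simps len by (rule expectation_bind_finite[OF IH(1) step(1)])
  also have "\<dots> = measure_pmf.expectation (run ys) (\<lambda>s. step_mean (insert r (set ys)) r g (fst s))"
    using step(2) by (intro integral_cong_AE) (auto simp: AE_measure_pmf_iff)
  finally show ?thesis .
qed

text \<open>This is the conditional expectation of \<open>g\<close> after \<open>card T\<close>
  steps, given that \<open>T\<close> is the set of the first \<open>card T\<close> arrivals.\<close>

definition order_mean :: "(('l, 'r) matching \<Rightarrow> real) \<Rightarrow> 'r set \<Rightarrow> real" where
  "order_mean g T = (\<Sum>ys\<in>permutations_of_set T.
     measure_pmf.expectation (run ys) (\<lambda>s. g (fst s))) / fact (card T)"

lemma order_mean_empty: "order_mean g {} = g {}"
  by (simp add: order_mean_def)

text \<open>The step of the last arrival \<open>r\<close> depends on \<open>T\<close> and on the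
  matching before it, but not on the order in which \<open>T - {r}\<close> arrived. Hence
  conditioning on \<open>r\<close> leaves a mean over uniformly random orders of
  \<open>T - {r}\<close>.\<close>

lemma order_mean_rec:
  assumes "T \<subseteq> R" "T \<noteq> {}"
  shows "order_mean g T = (\<Sum>r\<in>T. order_mean (step_mean T r g) (T - {r})) / card T"
proof -
  have fin: "finite T" using assms finite_R finite_subset by blast
  then obtain k where k: "card T = Suc k" using assms(2) by (metis card_0_eq not0_implies_Suc)
  have "(\<Sum>ys\<in>permutations_of_set T. measure_pmf.expectation (run ys) (\<lambda>s. g (fst s))) =
    (\<Sum>r\<in>T. \<Sum>ys\<in>permutations_of_set (T - {r}).
      measure_pmf.expectation (run ys) (\<lambda>s. step_mean T r g (fst s)))"
    unfolding sum_permutations_of_set[OF fin assms(2)]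
  proof (intro sum.cong refl)
    fix r ys assume r: "r \<in> T" and ys: "ys \<in> permutations_of_set (T - {r})"
    then have "insert r (set ys) = T" "distinct (r # ys)" by (auto dest: permutations_of_setD)
    then show "measure_pmf.expectation (run (r # ys)) (\<lambda>s. g (fst s)) =
      measure_pmf.expectation (run ys) (\<lambda>s. step_mean T r g (fst s))"
      using expectation_run_Cons[of r ys g] assms(1) by auto
  qed
  also have "\<dots> = (\<Sum>r\<in>T. order_mean (step_mean T r g) (T - {r}) * fact k)"
    using fin k by (intro sum.cong) (auto simp: order_mean_def)
  finally show ?thesis
    by (simp add: order_mean_def[of g T] k sum_distrib_right[symmetric])
qed

lemma order_mean_mono:
  assumes "T \<subseteq> R" "\<And>M. valid T M \<Longrightarrow> g M \<le> h M"
  shows "order_mean g T \<le> order_mean h T"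
  unfolding order_mean_def
proof (intro divide_right_mono sum_mono)
  fix ys assume "ys \<in> permutations_of_set T"
  then have "distinct ys" "set ys = T" by (auto dest: permutations_of_setD)
  then show "measure_pmf.expectation (run ys) (\<lambda>s. g (fst s))
      \<le> measure_pmf.expectation (run ys) (\<lambda>s. h (fst s))"
    using run_valid[of ys] assms by (intro expectation_mono_finite) auto
qed simp

lemma order_mean_add:
  assumes "T \<subseteq> R"
  shows "order_mean (\<lambda>M. g M + h M) T = order_mean g T + order_mean h T"
proof -
  have "measure_pmf.expectation (run ys) (\<lambda>s. g (fst s) + h (fst s)) =
    measure_pmf.expectation (run ys) (\<lambda>s. g (fst s)) +
    measure_pmf.expectation (run ys) (\<lambda>s. h (fst s))" if "ys \<in> permutations_of_set T" for ys
  proof -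
    have "distinct ys" "set ys = T" using that by (auto dest: permutations_of_setD)
    then have "finite (set_pmf (run ys))" using run_valid[of ys] assms by auto
    then show ?thesis by (simp add: integrable_measure_pmf_finite)
  qed
  then show ?thesis by (simp add: order_mean_def sum.distrib add_divide_distrib)
qed

lemma order_mean_cmult: "order_mean (\<lambda>M. c * g M) T = c * order_mean g T"
  by (simp add: order_mean_def sum_distrib_left)

lemma order_mean_const:
  assumes "T \<subseteq> R"
  shows "order_mean (\<lambda>M. c) T = c"
proof -
  have "finite T" using assms finite_R finite_subset by blast
  then show ?thesis by (simp add: order_mean_def)
qed

section \<open>Recursive bounds on the degrees of offline vertices\<close>

definition ev0 :: "'l \<Rightarrow> ('l, 'r) matching \<Rightarrow> real" where
  "ev0 l M = of_bool (deg M l = 0)"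

definition ev1 :: "'l \<Rightarrow> ('l, 'r) matching \<Rightarrow> real" where
  "ev1 l M = of_bool (deg M l < 2)"

text \<open>At most \<open>j\<close> choices are bad. As \<open>1 - j / c\<close> grows with the
  number \<open>c\<close> of available vertices, a lower bound \<open>z\<close> may take the place
  of \<open>c\<close>.\<close>

lemma fill_mean_ge:
  assumes "finite X" "card X \<le> j" "0 \<le> a" "0 < z" "z \<le> real (card (avail M))"
    and "\<And>x. 0 \<le> g (insert (x, r) M)"
    and "\<And>x. x \<in> avail M \<Longrightarrow> x \<notin> X \<Longrightarrow> a \<le> g (insert (x, r) M)"
  shows "a * (1 - real j / z) \<le> fill_mean r g M"
proof -
  define c where "c = real (card (avail M))"
  have c: "0 < c" "z \<le> c" using assms(4,5) by (auto simp: c_def)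
  have "card (avail M) \<le> card (avail M - X) + j"
    using diff_card_le_card_Diff[OF assms(1), of "avail M"] assms(2) by linarith
  then have "c - real j \<le> real (card (avail M - X))" unfolding c_def by linarith
  then have "a * (c - real j) \<le> (\<Sum>x\<in>avail M - X. a)"
    using assms(3) by (simp add: mult.commute[of a] mult_right_mono)
  also have "\<dots> \<le> (\<Sum>x\<in>avail M - X. g (insert (x, r) M))"
    using assms(7) by (intro sum_mono) auto
  also have "\<dots> \<le> (\<Sum>x\<in>avail M. g (insert (x, r) M))"
    using assms(6) finite_avail by (intro sum_mono2) auto
  finally have "a * (c - real j) / c \<le> fill_mean r g M"
    using c by (simp add: fill_mean_def c_def divide_right_mono)
  moreover have "a * (c - real j) / c = a * (1 - real j / c)" using c by (simp add: field_simps)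
  moreover have "a * (1 - real j / z) \<le> a * (1 - real j / c)"
    using c assms(3,4) by (intro mult_left_mono diff_left_mono divide_left_mono) auto
  ultimately show ?thesis by linarith
qed

lemma ev_bounds:
  "0 \<le> ev0 l M" "ev0 l M \<le> 1" "0 \<le> ev1 l M" "ev1 l M \<le> 1" "ev0 l M \<le> ev1 l M"
  by (auto simp: ev0_def ev1_def)

lemma fill_mean_nonneg: "(\<And>M. 0 \<le> g M) \<Longrightarrow> 0 \<le> fill_mean r g M"
  by (simp add: fill_mean_def sum_nonneg)

lemma step_mean_nonneg: "(\<And>M. 0 \<le> g M) \<Longrightarrow> 0 \<le> step_mean T r g M"
  by (simp add: step_mean_def fill_mean_nonneg)

context
  fixes T :: "'r set" and r :: 'r and M :: "('l, 'r) matching"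
  assumes valid: "valid (T - {r}) M" and T: "T \<subseteq> R" "r \<in> T"
begin

private lemma TR: "T - {r} \<subseteq> R" "r \<notin> T - {r}" "finite T"
  using T finite_R finite_subset by auto

private lemmas dins = deg_insert[OF valid TR(1,2)]

private lemma early_avail:
  assumes "card (T - {r}) < m"
  shows "x \<in> avail M \<Longrightarrow> deg M x = 0"
    "real m - real (card (T - {r})) \<le> real (card (avail M))"
proof -
  note e = avail_early[OF valid TR(1) assms]
  have "avail M = {l\<in>L. deg M l = 0}" using e(1) by (intro avail_zero) blast
  then show "x \<in> avail M \<Longrightarrow> deg M x = 0" by simp
  show "real m - real (card (T - {r})) \<le> real (card (avail M))" using e(2) by linarith
qed

context
  assumes early: "card (T - {r}) < m"
begin

private abbreviation (input) z where "z \<equiv> real m - real (card (T - {r}))"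

text \<open>Early random choices hit unmatched vertices only and so never take the second place of a
  vertex. This is why \<open>fill_ev1\<close> loses nothing.\<close>

private lemma avail_low:
  "x \<in> avail M \<Longrightarrow> deg M l < 2 \<Longrightarrow> deg M l + of_bool (x = l) < 2"
  using early_avail(1)[OF early, of x] by (cases "x = l") auto

lemma fill_ev0: "ev0 l M * (1 - 1 / z) \<le> fill_mean r (ev0 l) M"
  using fill_mean_ge[of "{l}" 1 "ev0 l M" z M "ev0 l" r] early early_avail[OF early]
  by (simp add: ev0_def dins)

lemma fill_ev1: "ev1 l M \<le> fill_mean r (ev1 l) M"
  using fill_mean_ge[of "{}" 0 "ev1 l M" z M "ev1 l" r] early early_avail(2)[OF early] avail_low
  by (simp add: ev1_def dins)

lemma fill_ev01:
  "ev0 l M * ev1 l' M * (1 - 1 / z) \<le> fill_mean r (\<lambda>M. ev0 l M * ev1 l' M) M"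
  using fill_mean_ge[of "{l}" 1 "ev0 l M * ev1 l' M" z M "\<lambda>M. ev0 l M * ev1 l' M" r]
    early early_avail(2)[OF early] avail_low
  by (simp add: ev0_def ev1_def dins)

lemma fill_ev00:
  "ev0 l M * ev0 l' M * (1 - 2 / z) \<le> fill_mean r (\<lambda>M. ev0 l M * ev0 l' M) M"
  using fill_mean_ge[of "{l, l'}" 2 "ev0 l M * ev0 l' M" z M "\<lambda>M. ev0 l M * ev0 l' M" r]
    early early_avail[OF early]
  by (simp add: ev0_def dins card_insert_if)

text \<open>The last summand is the gain over a forced random choice: if the partner has a free
  place, no random choice is made and \<open>l\<close> stays unmatched.\<close>

lemma step_ev0:
  assumes "partner T r \<noteq> l" "n div 4 \<le> card T"
  shows "ev0 l M * (1 - 1 / z) + ev0 l M * ev1 (partner T r) M / z \<le> step_mean T r (ev0 l) M"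
proof (cases "deg M (partner T r) < 2")
  case True
  have "z \<noteq> 0" using early by simp
  then have "ev0 l M * (1 - 1 / z) + ev0 l M * 1 / z = ev0 l M" by (simp add: algebra_simps)
  then show ?thesis
    using True assms by (simp add: step_mean_def ev0_def ev1_def dins)
next
  case False
  then have "step_mean T r (ev0 l) M = fill_mean r (ev0 l) M" "ev1 (partner T r) M = 0"
    by (simp_all add: step_mean_def ev1_def)
  then show ?thesis using fill_ev0[of l] by simp
qed

text \<open>If \<open>l\<close> is the partner, it needs one place for this arrival and one to be
  left over, hence \<open>ev0 l\<close> before the step.\<close>

lemma step_ev1:
  assumes "n div 4 \<le> card T"
  shows "partner T r = l \<Longrightarrow> ev0 l M \<le> step_mean T r (ev1 l) M"
    "partner T r \<noteq> l \<Longrightarrow> ev1 l M \<le> step_mean T r (ev1 l) M"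
  using assms fill_ev1[of l] ev_bounds[of l M]
  by (auto simp: step_mean_def ev0_def ev1_def dins)

lemma step_ev01:
  assumes "n div 4 \<le> card T" "partner T r \<noteq> l"
  shows "partner T r = l' \<Longrightarrow>
      ev0 l M * ev0 l' M \<le> step_mean T r (\<lambda>M. ev0 l M * ev1 l' M) M"
    "partner T r \<noteq> l' \<Longrightarrow>
      ev0 l M * ev1 l' M * (1 - 1 / z) \<le> step_mean T r (\<lambda>M. ev0 l M * ev1 l' M) M"
proof -
  have z: "0 \<le> 1 / z" using early by simp
  then have le: "ev0 l M * ev1 l' M * (1 - 1 / z) \<le> ev0 l M * ev1 l' M"
    by (simp add: ev0_def ev1_def)
  show "ev0 l M * ev0 l' M \<le> step_mean T r (\<lambda>M. ev0 l M * ev1 l' M) M" if "partner T r = l'"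
    using that assms fill_mean_nonneg[of "\<lambda>M. ev0 l M * ev1 l' M" r M]
    by (auto simp: step_mean_def ev0_def ev1_def dins)
  show "ev0 l M * ev1 l' M * (1 - 1 / z) \<le> step_mean T r (\<lambda>M. ev0 l M * ev1 l' M) M"
    if "partner T r \<noteq> l'"
  proof (cases "deg M (partner T r) < 2")
    case True
    then show ?thesis using that assms le by (simp add: step_mean_def ev0_def ev1_def dins)
  next
    case False
    then show ?thesis using fill_ev01[of l l'] by (simp add: step_mean_def)
  qed
qed

lemma step_ev00:
  assumes "n div 4 \<le> card T" "partner T r \<noteq> l" "partner T r \<noteq> l'"
  shows "ev0 l M * ev0 l' M * (1 - 2 / z) \<le> step_mean T r (\<lambda>M. ev0 l M * ev0 l' M) M"
proof (cases "deg M (partner T r) < 2")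
  case True
  have "0 \<le> 2 / z" using early by simp
  then have "ev0 l M * ev0 l' M * (1 - 2 / z) \<le> ev0 l M * ev0 l' M"
    by (simp add: ev0_def)
  then show ?thesis using True assms by (simp add: step_mean_def ev0_def dins)
next
  case False
  then show ?thesis using fill_ev00[of l l'] by (simp add: step_mean_def)
qed

end

text \<open>While unmatched vertices remain, a random choice takes one of them and cannot fill up
  any vertex. Otherwise exactly \<open>n - card (T - {r})\<close> vertices are available, and at
  most one of these choices is bad.\<close>

lemma step_ev1_late:
  assumes "n div 4 \<le> card T" "partner T r \<noteq> l"
  shows "ev1 l M * (1 - 1 / (real n - real (card (T - {r})))) \<le> step_mean T r (ev1 l) M"
proof -
  have kn: "card (T - {r}) < n"
    using T TR(3) card_R finite_R
    by (metis card_Diff1_less card_mono order_less_le_trans)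
  let ?y = "real n - real (card (T - {r}))"
  have le: "ev1 l M * (1 - 1 / ?y) \<le> ev1 l M" using kn by (simp add: ev1_def)
  show ?thesis
  proof (cases "deg M (partner T r) < 2")
    case True
    then show ?thesis using assms le by (simp add: step_mean_def ev1_def dins)
  next
    case False
    have "ev1 l M * (1 - 1 / ?y) \<le> fill_mean r (ev1 l) M"
    proof (cases "\<exists>l\<in>L. deg M l = 0")
      case True
      then have "avail M = {l\<in>L. deg M l = 0}" by (intro avail_zero) blast
      moreover have "avail M \<noteq> {}" using avail_nonempty[OF valid TR(1) kn] .
      \<comment> \<open>No choice is bad here, so any positive lower bound for the number of
        available vertices serves, for instance \<open>1\<close>.\<close>
      ultimately have "ev1 l M * (1 - real 0 / 1) \<le> fill_mean r (ev1 l) M"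
        using finite_avail[of M]
        by (intro fill_mean_ge[of "{}"]) (auto simp: ev1_def dins card_gt_0_iff Suc_le_eq)
      then show ?thesis using le by simp
    next
      case False
      then have "card (avail M) + card (T - {r}) = n" by (rule card_avail_late[OF valid TR(1)])
      then show ?thesis
        using fill_mean_ge[of "{l}" 1 "ev1 l M" ?y M "ev1 l" r] kn by (simp add: ev1_def dins)
    qed
    then show ?thesis using False by (simp add: step_mean_def)
  qed
qed

end

text \<open>The bounds are uniform in the set and in the vertices, because the recursion passes from
  \<open>T\<close> to all sets \<open>T - {r}\<close>, and the partner varies with
  \<open>r\<close>.\<close>

definition low0 :: "nat \<Rightarrow> real \<Rightarrow> bool" where
  "low0 k c \<longleftrightarrow> (\<forall>T l. T \<subseteq> R \<longrightarrow> card T = k \<longrightarrow> l \<in> L \<longrightarrow> c \<le> order_mean (ev0 l) T)"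

definition low1 :: "nat \<Rightarrow> real \<Rightarrow> bool" where
  "low1 k c \<longleftrightarrow> (\<forall>T l. T \<subseteq> R \<longrightarrow> card T = k \<longrightarrow> l \<in> L \<longrightarrow> c \<le> order_mean (ev1 l) T)"

definition low01 :: "nat \<Rightarrow> real \<Rightarrow> bool" where
  "low01 k c \<longleftrightarrow> (\<forall>T l l'. T \<subseteq> R \<longrightarrow> card T = k \<longrightarrow> l \<in> L \<longrightarrow> l' \<in> L \<longrightarrow> l \<noteq> l' \<longrightarrow>
     c \<le> order_mean (\<lambda>M. ev0 l M * ev1 l' M) T)"

definition low00 :: "nat \<Rightarrow> real \<Rightarrow> bool" where
  "low00 k c \<longleftrightarrow> (\<forall>T l l'. T \<subseteq> R \<longrightarrow> card T = k \<longrightarrow> l \<in> L \<longrightarrow> l' \<in> L \<longrightarrow> l \<noteq> l' \<longrightarrow>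
     c \<le> order_mean (\<lambda>M. ev0 l M * ev0 l' M) T)"

lemma low_zero: "low0 0 1" "low1 0 1" "low01 0 1" "low00 0 1"
proof -
  have "card T = 0 \<longleftrightarrow> T = {}" if "T \<subseteq> R" for T
    using finite_subset[OF that finite_R] by simp
  moreover have "ev0 l {} = 1" "ev1 l {} = 1" for l by (simp_all add: ev0_def ev1_def deg_def)
  ultimately show "low0 0 1" "low1 0 1" "low01 0 1" "low00 0 1"
    unfolding low0_def low1_def low01_def low00_def by (simp_all cong: imp_cong add: order_mean_empty)
qed

lemma order_mean_nonneg: "T \<subseteq> R \<Longrightarrow> (\<And>M. 0 \<le> g M) \<Longrightarrow> 0 \<le> order_mean g T"
  using order_mean_mono[of T "\<lambda>_. 0" g] order_mean_const[of T 0] by simp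

lemma low_nonneg: "low0 k 0" "low01 k 0" "low00 k 0"
  by (auto simp: low0_def low01_def low00_def ev_bounds intro!: order_mean_nonneg)

lemma low_mono:
  assumes "c' \<le> c"
  shows "low0 k c \<Longrightarrow> low0 k c'"
    "low1 k c \<Longrightarrow> low1 k c'"
    "low01 k c \<Longrightarrow> low01 k c'"
    "low00 k c \<Longrightarrow> low00 k c'"
proof -
  show "low0 k c'" if "low0 k c"
    unfolding low0_def
    by (intro allI impI order_trans[OF assms] that[unfolded low0_def, rule_format])
  show "low1 k c'" if "low1 k c"
    unfolding low1_def
    by (intro allI impI order_trans[OF assms] that[unfolded low1_def, rule_format])
  show "low01 k c'" if "low01 k c"
    unfolding low01_def
    by (intro allI impI order_trans[OF assms] that[unfolded low01_def, rule_format])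
  show "low00 k c'" if "low00 k c"
    unfolding low00_def
    by (intro allI impI order_trans[OF assms] that[unfolded low00_def, rule_format])
qed

lemma order_mean_ge:
  assumes "T \<subseteq> R" "card T = Suc k"
    and "\<And>r. r \<in> T \<Longrightarrow> T - {r} \<subseteq> R \<Longrightarrow> card (T - {r}) = k \<Longrightarrow>
      v r \<le> order_mean (step_mean T r g) (T - {r})"
  shows "(\<Sum>r\<in>T. v r) / Suc k \<le> order_mean g T"
proof -
  have "finite T" "T \<noteq> {}" using assms(1,2) finite_R finite_subset by auto
  then show ?thesis
    using assms by (subst order_mean_rec) (auto intro!: divide_right_mono sum_mono)
qed

text \<open>Capacity two limits the hits on \<open>l\<close> to two; as
  \<open>\<alpha> \<le> \<beta>\<close>, exactly two hits are the worst case.\<close>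

lemma sum_hits_ge:
  fixes \<alpha> \<beta> :: real
  assumes "T \<subseteq> R" "l \<in> L" "\<alpha> \<le> \<beta>"
  shows "2 * \<alpha> + (real (card T) - 2) * \<beta> \<le> (\<Sum>r\<in>T. if partner T r = l then \<alpha> else \<beta>)"
proof -
  have fin: "finite T" using assms(1) finite_R finite_subset by blast
  define a where "a = real (card {r\<in>T. partner T r = l})"
  have "(\<Sum>r\<in>T. if partner T r = l then \<alpha> else \<beta>) = (\<Sum>r\<in>T. \<beta> - (\<beta> - \<alpha>) * of_bool (partner T r = l))"
    by (intro sum.cong) auto
  also have "\<dots> = card T * \<beta> - (\<beta> - \<alpha>) * a"
    using fin by (simp add: sum_subtractf sum_distrib_left[symmetric] a_def of_bool_def
        sum.If_cases Int_def)
  finally have "(\<Sum>r\<in>T. if partner T r = l then \<alpha> else \<beta>) = card T * \<beta> - (\<beta> - \<alpha>) * a" .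
  moreover have "(\<beta> - \<alpha>) * a \<le> (\<beta> - \<alpha>) * 2"
    using card_hits[OF assms(1,2)] assms(3) by (intro mult_left_mono) (auto simp: a_def)
  ultimately show ?thesis by (simp add: algebra_simps)
qed

lemma sum_two_hits_ge:
  fixes \<alpha> \<alpha>' \<beta> :: real
  assumes "T \<subseteq> R" "l \<in> L" "l' \<in> L" "l \<noteq> l'" "\<alpha> \<le> \<beta>" "\<alpha>' \<le> \<beta>"
  shows "2 * \<alpha> + 2 * \<alpha>' + (real (card T) - 4) * \<beta> \<le>
    (\<Sum>r\<in>T. if partner T r = l then \<alpha> else if partner T r = l' then \<alpha>' else \<beta>)"
proof -
  have "(\<Sum>r\<in>T. if partner T r = l then \<alpha> else if partner T r = l' then \<alpha>' else \<beta>) =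
    (\<Sum>r\<in>T. (if partner T r = l then \<alpha> else \<beta>) + (if partner T r = l' then \<alpha>' else \<beta>) - \<beta>)"
    using assms(4) by (intro sum.cong) auto
  also have "\<dots> = (\<Sum>r\<in>T. if partner T r = l then \<alpha> else \<beta>) +
      (\<Sum>r\<in>T. if partner T r = l' then \<alpha>' else \<beta>) - card T * \<beta>"
    by (simp add: sum.distrib sum_subtractf)
  finally show ?thesis
    using sum_hits_ge[OF assms(1,2,5)] sum_hits_ge[OF assms(1,3,6)] by (simp add: algebra_simps)
qed

lemma order_mean_step_ge:
  assumes "T \<subseteq> R" "r \<in> T" "\<And>M. valid (T - {r}) M \<Longrightarrow> c * h M \<le> step_mean T r g M"
    and "b \<le> order_mean h (T - {r})" "0 \<le> c"
  shows "b * c \<le> order_mean (step_mean T r g) (T - {r})"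
proof -
  have "b * c \<le> c * order_mean h (T - {r})" using assms(4,5) by (subst mult.commute) (rule mult_left_mono)
  also have "\<dots> \<le> order_mean (step_mean T r g) (T - {r})"
    using assms(1,3) by (subst order_mean_cmult[symmetric], intro order_mean_mono) auto
  finally show ?thesis .
qed

section \<open>Recursions for the uniform bounds\<close>

lemma explore:
  assumes "Suc k < n div 4" "k < m"
  shows "low0 k c \<Longrightarrow> low0 (Suc k) (c * (1 - 1 / (real m - real k)))"
    "low1 k c \<Longrightarrow> low1 (Suc k) c"
    "low01 k c \<Longrightarrow> low01 (Suc k) (c * (1 - 1 / (real m - real k)))"
    "low00 k c \<Longrightarrow> k + 2 \<le> m \<Longrightarrow> low00 (Suc k) (c * (1 - 2 / (real m - real k)))"
proof -
  have z: "1 \<le> real m - real k" using assms(2) by simp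
  \<comment> \<open>All four bounds are instances of this one; \<open>j\<close> counts the vertices
    that the random choice has to avoid.\<close>
  have main: "a * (1 - j / (real m - real k)) \<le> order_mean g T"
    if "T \<subseteq> R" "card T = Suc k" "j \<le> real m - real k"
      and h: "\<And>T. T \<subseteq> R \<Longrightarrow> card T = k \<Longrightarrow> a \<le> order_mean g T"
      and s: "\<And>r M. r \<in> T \<Longrightarrow> valid (T - {r}) M \<Longrightarrow> card (T - {r}) = k \<Longrightarrow>
        g M * (1 - j / (real m - real k)) \<le> fill_mean r g M" for T j a g
  proof -
    have "a * (1 - j / (real m - real k)) \<le> order_mean (step_mean T r g) (T - {r})"
      if r: "r \<in> T" "T - {r} \<subseteq> R" "card (T - {r}) = k" for r
    proof (rule order_mean_step_ge[OF \<open>T \<subseteq> R\<close> r(1), where h = g])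
      show "(1 - j / (real m - real k)) * g M \<le> step_mean T r g M" if "valid (T - {r}) M" for M
        using s[OF r(1) that r(3)] \<open>card T = Suc k\<close> assms(1)
        by (simp add: step_mean_def mult.commute)
      show "a \<le> order_mean g (T - {r})" using h[OF r(2,3)] .
      show "0 \<le> 1 - j / (real m - real k)" using z \<open>j \<le> real m - real k\<close> by simp
    qed
    from order_mean_ge[OF that(1,2) this] that(2) show ?thesis by simp
  qed
  have fill: "card (T - {r}) < m" "real (card (T - {r})) = real k" if "card (T - {r}) = k"
    for T and r :: 'r using that assms(2) by auto
  show "low0 (Suc k) (c * (1 - 1 / (real m - real k)))" if low: "low0 k c"
    unfolding low0_def
  proof (intro allI impI, rule main)
    fix T l r M assume "T \<subseteq> R" "l \<in> L" "r \<in> T" "valid (T - {r}) M" and c: "card (T - {r}) = k"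
    then show "ev0 l M * (1 - 1 / (real m - real k)) \<le> fill_mean r (ev0 l) M"
      using fill_ev0[of T r M l] fill[OF c] by simp
  qed (use low z in \<open>auto simp: low0_def\<close>)
  show "low1 (Suc k) c" if low: "low1 k c"
    unfolding low1_def
  proof (intro allI impI)
    fix T l assume T: "T \<subseteq> R" "card T = Suc k" and l: "l \<in> L"
    have "c * (1 - 0 / (real m - real k)) \<le> order_mean (ev1 l) T"
    proof (rule main[OF T])
      fix r M assume "r \<in> T" "valid (T - {r}) M" and c: "card (T - {r}) = k"
      then show "ev1 l M * (1 - 0 / (real m - real k)) \<le> fill_mean r (ev1 l) M"
        using fill_ev1[of T r M l] fill[OF c] T by simp
    qed (use low z l in \<open>auto simp: low1_def\<close>)
    then show "c \<le> order_mean (ev1 l) T" by simp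
  qed
  show "low01 (Suc k) (c * (1 - 1 / (real m - real k)))" if low: "low01 k c"
    unfolding low01_def
  proof (intro allI impI, rule main)
    fix T l l' r M assume "T \<subseteq> R" "r \<in> T" "valid (T - {r}) M" and c: "card (T - {r}) = k"
    then show "ev0 l M * ev1 l' M * (1 - 1 / (real m - real k))
        \<le> fill_mean r (\<lambda>M. ev0 l M * ev1 l' M) M"
      using fill_ev01[of T r M l l'] fill[OF c] by simp
  qed (use low z in \<open>auto simp: low01_def\<close>)
  show "low00 (Suc k) (c * (1 - 2 / (real m - real k)))" if low: "low00 k c" and k2: "k + 2 \<le> m"
    unfolding low00_def
  proof (intro allI impI, rule main)
    fix T l l' r M assume "T \<subseteq> R" "r \<in> T" "valid (T - {r}) M" and c: "card (T - {r}) = k"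
    then show "ev0 l M * ev0 l' M * (1 - 2 / (real m - real k))
        \<le> fill_mean r (\<lambda>M. ev0 l M * ev0 l' M) M"
      using fill_ev00[of T r M l l'] fill[OF c] by simp
  qed (use low k2 in \<open>auto simp: low00_def\<close>)
qed

context
  fixes k :: nat
  assumes exploit: "n div 4 \<le> Suc k"
begin

text \<open>An arrival with partner \<open>l\<close> is credited with nothing. For any other arrival
  \<open>step_ev0\<close> applies, with the joint bound \<open>h\<close> used for \<open>l\<close>
  and the partner.\<close>

lemma exploit_0:
  assumes "k < m" "low0 k f" "low01 k h"
    and \<beta>: "\<beta> = f * (1 - 1 / (real m - real k)) + h / (real m - real k)" "0 \<le> \<beta>"
  shows "low0 (Suc k) ((1 - 2 / Suc k) * \<beta>)"
  unfolding low0_def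
proof (intro allI impI)
  fix T l assume T: "T \<subseteq> R" "card T = Suc k" and l: "l \<in> L"
  let ?z = "real m - real k"
  have z: "1 \<le> ?z" using assms(1) by simp
  have "(if partner T r = l then 0 else \<beta>) \<le> order_mean (step_mean T r (ev0 l)) (T - {r})"
    if r: "r \<in> T" "T - {r} \<subseteq> R" "card (T - {r}) = k" for r
  proof (cases "partner T r = l")
    case True
    then show ?thesis
      using r(2) by (simp add: order_mean_nonneg step_mean_nonneg ev_bounds)
  next
    case False
    let ?x = "partner T r"
    have x: "?x \<in> L" using partner T r by blast
    have "\<beta> \<le> (1 - 1 / ?z) * order_mean (ev0 l) (T - {r}) +
        1 / ?z * order_mean (\<lambda>M. ev0 l M * ev1 ?x M) (T - {r})"
      unfolding \<beta>(1) mult.commute[of f] divide_inverse[of h]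
      using assms(2,3) z x l False r
      by (intro add_mono mult_left_mono) (auto simp: low0_def low01_def divide_simps)
    also have "\<dots> = order_mean (\<lambda>M. (1 - 1 / ?z) * ev0 l M + 1 / ?z * (ev0 l M * ev1 ?x M)) (T - {r})"
      using r(2) by (simp only: order_mean_add order_mean_cmult)
    also have "\<dots> \<le> order_mean (step_mean T r (ev0 l)) (T - {r})"
      using step_ev0[OF _ T(1) r(1) _ False] assms(1) exploit r T
      by (intro order_mean_mono) (auto simp: mult.commute)
    finally show ?thesis using False by simp
  qed
  from order_mean_ge[OF T this]
  have "(\<Sum>r\<in>T. if partner T r = l then 0 else \<beta>) / Suc k \<le> order_mean (ev0 l) T" .
  moreover have "(real (Suc k) - 2) * \<beta> / Suc k \<le> (\<Sum>r\<in>T. if partner T r = l then 0 else \<beta>) / Suc k"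
    using sum_hits_ge[OF T(1) l \<beta>(2)] T(2) by (intro divide_right_mono) auto
  moreover have "(real (Suc k) - 2) * \<beta> / Suc k = (1 - 2 / Suc k) * \<beta>"
    by (simp add: field_simps)
  ultimately show "(1 - 2 / Suc k) * \<beta> \<le> order_mean (ev0 l) T" by linarith
qed

lemma exploit_1:
  assumes "k < m" "low0 k f" "low1 k b" "f \<le> b"
  shows "low1 (Suc k) (2 / Suc k * f + (1 - 2 / Suc k) * b)"
  unfolding low1_def
proof (intro allI impI)
  fix T l assume T: "T \<subseteq> R" "card T = Suc k" and l: "l \<in> L"
  have "(if partner T r = l then f else b) \<le> order_mean (step_mean T r (ev1 l)) (T - {r})"
    if r: "r \<in> T" "T - {r} \<subseteq> R" "card (T - {r}) = k" for r
  proof -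
    note s = step_ev1[OF _ T(1) r(1)]
    have "(if partner T r = l then f else b) \<le>
        order_mean (if partner T r = l then ev0 l else ev1 l) (T - {r})"
      using assms(2,3) r l by (auto simp: low0_def low1_def)
    also have "\<dots> \<le> order_mean (step_mean T r (ev1 l)) (T - {r})"
      using s assms(1) exploit r T by (intro order_mean_mono) auto
    finally show ?thesis .
  qed
  from order_mean_ge[OF T this]
  have "(\<Sum>r\<in>T. if partner T r = l then f else b) / Suc k \<le> order_mean (ev1 l) T" .
  moreover have "(2 * f + (real (Suc k) - 2) * b) / Suc k \<le>
      (\<Sum>r\<in>T. if partner T r = l then f else b) / Suc k"
    using sum_hits_ge[OF T(1) l assms(4)] T(2) by (intro divide_right_mono) auto
  moreover have "(2 * f + (real (Suc k) - 2) * b) / Suc k = 2 / Suc k * f + (1 - 2 / Suc k) * b"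
    by (simp add: add_divide_distrib diff_divide_distrib left_diff_distrib del: of_nat_Suc)
  ultimately show "2 / Suc k * f + (1 - 2 / Suc k) * b \<le> order_mean (ev1 l) T" by linarith
qed

text \<open>Meant for \<open>m \<le> k\<close>, where no positive bound for being unmatched is
  available: a hit on \<open>l\<close> counts as lost.\<close>

lemma exploit_1_late:
  assumes "k < n" "low1 k b" "0 \<le> b"
  shows "low1 (Suc k) ((1 - 2 / Suc k) * (b * (1 - 1 / (real n - real k))))"
  unfolding low1_def
proof (intro allI impI)
  fix T l assume T: "T \<subseteq> R" "card T = Suc k" and l: "l \<in> L"
  define \<beta> where "\<beta> = b * (1 - 1 / (real n - real k))"
  have y: "0 \<le> 1 - 1 / (real n - real k)" using assms(1) by (simp add: field_simps)
  then have \<beta>: "0 \<le> \<beta>" using assms(3) by (simp add: \<beta>_def)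
  have "(if partner T r = l then 0 else \<beta>) \<le> order_mean (step_mean T r (ev1 l)) (T - {r})"
    if r: "r \<in> T" "T - {r} \<subseteq> R" "card (T - {r}) = k" for r
  proof (cases "partner T r = l")
    case True
    then show ?thesis
      using r(2) by (simp add: order_mean_nonneg step_mean_nonneg ev_bounds)
  next
    case False
    have "\<beta> \<le> order_mean (step_mean T r (ev1 l)) (T - {r})"
      unfolding \<beta>_def
      using step_ev1_late[OF _ T(1) r(1) _ False] y assms(2) exploit r T l
      by (intro order_mean_step_ge[where h = "ev1 l"]) (auto simp: low1_def mult.commute)
    then show ?thesis using False by simp
  qed
  from order_mean_ge[OF T this]
  have "(\<Sum>r\<in>T. if partner T r = l then 0 else \<beta>) / Suc k \<le> order_mean (ev1 l) T" .
  moreover have "(real (Suc k) - 2) * \<beta> / Suc k \<le> (\<Sum>r\<in>T. if partner T r = l then 0 else \<beta>) / Suc k"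
    using sum_hits_ge[OF T(1) l \<beta>] T(2) by (intro divide_right_mono) auto
  moreover have "(real (Suc k) - 2) * \<beta> / Suc k = (1 - 2 / Suc k) * \<beta>"
    by (simp add: field_simps)
  ultimately show "(1 - 2 / Suc k) * (b * (1 - 1 / (real n - real k))) \<le> order_mean (ev1 l) T"
    by (simp add: \<beta>_def)
qed

text \<open>The partner of the last arrival may be \<open>l\<close>, which is credited with nothing,
  or \<open>l'\<close>, which requires both vertices to have been unmatched, or another vertex,
  which leaves only the danger of the random choice. Since \<open>0 \<le> \<beta>\<close> and
  \<open>e \<le> \<beta>\<close>, two hits on each vertex are the worst case.\<close>

lemma exploit_01:
  assumes "k < m" "low01 k h" "low00 k e"
    and \<beta>: "\<beta> = h * (1 - 1 / (real m - real k))" "e \<le> \<beta>" "0 \<le> \<beta>"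
  shows "low01 (Suc k) (2 / Suc k * e + (1 - 4 / Suc k) * \<beta>)"
  unfolding low01_def
proof (intro allI impI)
  fix T l l' assume T: "T \<subseteq> R" "card T = Suc k" and l: "l \<in> L" "l' \<in> L" "l \<noteq> l'"
  let ?z = "real m - real k"
  let ?g = "\<lambda>M. ev0 l M * ev1 l' M"
  let ?v = "\<lambda>r. if partner T r = l then 0 else if partner T r = l' then e else \<beta>"
  have z: "0 \<le> 1 - 1 / ?z" using assms(1) by (simp add: field_simps)
  have "?v r \<le> order_mean (step_mean T r ?g) (T - {r})"
    if r: "r \<in> T" "T - {r} \<subseteq> R" "card (T - {r}) = k" for r
  proof (cases "partner T r = l")
    case True
    then show ?thesis
      using r(2) by (simp add: order_mean_nonneg step_mean_nonneg ev_bounds)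
  next
    case False
    note s = step_ev01[OF _ T(1) r(1) _ _ False]
    show ?thesis
    proof (cases "partner T r = l'")
      case True
      have "e \<le> order_mean (\<lambda>M. ev0 l M * ev0 l' M) (T - {r})"
        using assms(3) r l by (auto simp: low00_def)
      also have "\<dots> \<le> order_mean (step_mean T r ?g) (T - {r})"
        using s(1)[OF _ _ _ True] assms(1) exploit r T by (intro order_mean_mono) auto
      finally show ?thesis using True l(3) by simp
    next
      case F: False
      have "\<beta> \<le> order_mean (step_mean T r ?g) (T - {r})"
        unfolding \<beta>(1)
        using s(2)[OF _ _ _ F] z assms(1,2) exploit r T l
        by (intro order_mean_step_ge[where h = ?g]) (auto simp: low01_def mult.commute)
      then show ?thesis using False F by simp
    qed
  qed
  from order_mean_ge[OF T this]
  have "(\<Sum>r\<in>T. ?v r) / Suc k \<le> order_mean ?g T" .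
  moreover have "(2 * 0 + 2 * e + (real (Suc k) - 4) * \<beta>) / Suc k \<le> (\<Sum>r\<in>T. ?v r) / Suc k"
    using sum_two_hits_ge[OF T(1) l \<beta>(3,2)] T(2) by (intro divide_right_mono) auto
  moreover have "(2 * 0 + 2 * e + (real (Suc k) - 4) * \<beta>) / Suc k =
      2 / Suc k * e + (1 - 4 / Suc k) * \<beta>"
    by (simp add: add_divide_distrib diff_divide_distrib left_diff_distrib del: of_nat_Suc)
  ultimately show "2 / Suc k * e + (1 - 4 / Suc k) * \<beta> \<le> order_mean ?g T" by linarith
qed

lemma exploit_00:
  assumes "k + 2 \<le> m" "low00 k e" "0 \<le> e"
    and \<beta>: "\<beta> = e * (1 - 2 / (real m - real k))"
  shows "low00 (Suc k) ((1 - 4 / Suc k) * \<beta>)"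
  unfolding low00_def
proof (intro allI impI)
  fix T l l' assume T: "T \<subseteq> R" "card T = Suc k" and l: "l \<in> L" "l' \<in> L" "l \<noteq> l'"
  let ?z = "real m - real k"
  let ?g = "\<lambda>M. ev0 l M * ev0 l' M"
  let ?v = "\<lambda>r. if partner T r = l then 0 else if partner T r = l' then 0 else \<beta>"
  have z: "0 \<le> 1 - 2 / ?z" using assms(1) by (simp add: field_simps)
  then have \<beta>0: "0 \<le> \<beta>" using assms(3) by (simp add: \<beta>)
  have "?v r \<le> order_mean (step_mean T r ?g) (T - {r})"
    if r: "r \<in> T" "T - {r} \<subseteq> R" "card (T - {r}) = k" for r
  proof (cases "partner T r = l \<or> partner T r = l'")
    case True
    then show ?thesis
      using r(2) by (auto simp add: order_mean_nonneg step_mean_nonneg ev_bounds)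
  next
    case False
    then have F: "partner T r \<noteq> l" "partner T r \<noteq> l'" by auto
    have "\<beta> \<le> order_mean (step_mean T r ?g) (T - {r})"
      unfolding \<beta>
      using step_ev00[OF _ T(1) r(1) _ _ F] z assms(1,2) exploit r T l
      by (intro order_mean_step_ge[where h = ?g]) (auto simp: low00_def mult.commute)
    then show ?thesis using F by simp
  qed
  from order_mean_ge[OF T this]
  have "(\<Sum>r\<in>T. ?v r) / Suc k \<le> order_mean ?g T" .
  moreover have "(2 * 0 + 2 * 0 + (real (Suc k) - 4) * \<beta>) / Suc k \<le> (\<Sum>r\<in>T. ?v r) / Suc k"
    using sum_two_hits_ge[OF T(1) l \<beta>0 \<beta>0] T(2) by (intro divide_right_mono) auto
  moreover have "(2 * 0 + 2 * 0 + (real (Suc k) - 4) * \<beta>) / Suc k = (1 - 4 / Suc k) * \<beta>"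
    by (simp add: field_simps)
  ultimately show "(1 - 4 / Suc k) * \<beta> \<le> order_mean ?g T" by linarith
qed

end

section \<open>From free places to weight\<close>

lemma weight_insert:
  assumes "valid T M" "T \<subseteq> R" "r \<notin> T"
  shows "weight w (insert (x, r) M) = w x r + weight w M"
proof -
  have "(x, r) \<notin> M" using assms by (auto simp: valid_def)
  then show ?thesis using finite_valid[OF assms(1,2)] by (simp add: weight_def)
qed

lemma weight_opt:
  assumes "T \<subseteq> R"
  shows "weight w (opt T) = (\<Sum>r\<in>T. w (partner T r) r)"
  by (simp add: weight_def opt_eq[OF assms] sum.reindex inj_on_def)

text \<open>Deleting the edge at \<open>r\<close> from \<open>opt T\<close> leaves a competitor of
  \<open>opt (T - {r})\<close>.\<close>

lemma weight_opt_remove: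
  assumes T: "T \<subseteq> R" "r \<in> T"
  shows "weight w (opt T) - w (partner T r) r \<le> weight w (opt (T - {r}))"
proof -
  have fin: "finite T" using T finite_R finite_subset by blast
  let ?M = "opt T - {(partner T r, r)}"
  have o: "cap_matching L T (opt T)" "matches_all T (opt T)"
    using opt_max[OF T(1)] by (auto simp: is_max_matching_def)
  have sub: "opt T \<subseteq> L \<times> T" using o(1) by (simp add: cap_matching_def)
  have finM: "finite (opt T)" using sub finite_L fin by (meson finite_SigmaI finite_subset)
  have mem: "(l, r') \<in> ?M \<longleftrightarrow> (l, r') \<in> opt T \<and> r' \<noteq> r" for l r'
    using partner(1)[OF T] by auto
  have "card {l. (l, r') \<in> ?M} \<le> 1" if "r' \<in> T - {r}" for r'
  proof -
    have "{l. (l, r') \<in> ?M} = {l. (l, r') \<in> opt T}" using that by (auto simp: mem)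
    then show ?thesis using o(1) that by (simp add: cap_matching_def)
  qed
  moreover have "card {r'. (l, r') \<in> ?M} \<le> 2" if "l \<in> L" for l
  proof -
    have "{r'. (l, r') \<in> opt T} \<subseteq> T" using sub by blast
    then have "card {r'. (l, r') \<in> ?M} \<le> card {r'. (l, r') \<in> opt T}"
      using fin finite_subset by (intro card_mono) (blast, blast)
    also have "\<dots> \<le> 2" using o(1) that by (simp add: cap_matching_def)
    finally show ?thesis .
  qed
  moreover have "?M \<subseteq> L \<times> (T - {r})" using sub mem by blast
  ultimately have "cap_matching L (T - {r}) ?M" by (simp add: cap_matching_def del: Diff_iff)
  moreover have "matches_all (T - {r}) ?M"
    using o(2) unfolding matches_all_def mem by blast
  ultimately have "weight w ?M \<le> weight w (opt (T - {r}))"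
    using opt_max[of "T - {r}"] T by (auto simp: is_max_matching_def)
  moreover have "(partner T r, r) \<in> opt T" using partner(1)[OF T] by simp
  ultimately show ?thesis
    using finM by (simp add: weight_def sum_diff1)
qed

text \<open>Randomly chosen edges are credited only with non-negativity of their weight; the optimal
  edge is credited in full whenever exploitation can use it.\<close>

lemma step_weight:
  assumes "valid (T - {r}) M" "T \<subseteq> R" "r \<in> T"
  shows "weight w M + of_bool (n div 4 \<le> card T) * (w (partner T r) r * ev1 (partner T r) M)
    \<le> step_mean T r (weight w) M"
proof -
  have TR: "T - {r} \<subseteq> R" "r \<notin> T - {r}" using assms by auto
  note W = weight_insert[OF assms(1) TR]
  have kn: "card (T - {r}) < n"
    using assms card_R finite_R finite_subset[OF assms(2) finite_R]
    by (metis card_Diff1_less card_mono order_less_le_trans)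
  have fill: "weight w M \<le> fill_mean r (weight w) M"
  proof -
    have ne: "0 < real (card (avail M))"
      using avail_nonempty[OF assms(1) TR(1) kn] finite_avail by (simp add: card_gt_0_iff)
    have "(\<Sum>l\<in>avail M. weight w M) \<le> (\<Sum>l\<in>avail M. weight w (insert (l, r) M))"
      using w_nonneg[OF subsetD[OF avail_subset] subsetD[OF assms(2,3)]]
      by (intro sum_mono) (simp add: W)
    then show ?thesis using ne by (simp add: fill_mean_def field_simps)
  qed
  show ?thesis
  proof (cases "card T < n div 4 \<or> 2 \<le> deg M (partner T r)")
    case True
    then have "step_mean T r (weight w) M = fill_mean r (weight w) M"
      "of_bool (n div 4 \<le> card T) * (w (partner T r) r * ev1 (partner T r) M) = 0"
      by (auto simp: step_mean_def ev1_def)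
    then show ?thesis using fill by (simp only: add_0_right)
  next
    case False
    then show ?thesis by (simp add: step_mean_def W ev1_def)
  qed
qed

text \<open>Averaged over the last arrival \<open>r\<close>, the optimal edge has weight
  \<open>weight w (opt T) / card T\<close>. It fits with probability at least \<open>b k\<close>,
  whatever \<open>r\<close> is, because \<open>low1 k\<close> is uniform in the set and the vertex.
  The edges used before are handled by induction on \<open>T - {r}\<close>.\<close>

lemma order_mean_weight:
  fixes b :: "nat \<Rightarrow> real"
  assumes low: "\<And>k. k < n \<Longrightarrow> n div 4 \<le> Suc k \<Longrightarrow> low1 k (b k)"
    and nonneg: "\<And>k. 0 \<le> b k"
    and "T \<subseteq> R"
  shows "(\<Sum>k<card T. of_bool (n div 4 \<le> Suc k) * b k) / card T * weight w (opt T)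
    \<le> order_mean (weight w) T"
  using assms(3)
proof (induction "card T" arbitrary: T)
  case 0
  then have "T = {}" using finite_subset[OF 0(2) finite_R] by simp
  then show ?case by (simp add: order_mean_empty weight_def)
next
  case (Suc k)
  note T = Suc.prems and card = Suc.hyps(2)[symmetric]
  define S where "S = (\<Sum>k<k. of_bool (n div 4 \<le> Suc k) * b k)"
  define q where "q = of_bool (n div 4 \<le> Suc k) * b k"
  have S: "0 \<le> S" using nonneg by (auto simp: S_def intro!: sum_nonneg)
  have kn: "k < n"
    using card card_mono[OF finite_R T] card_R by simp
  let ?W = "weight w (opt T)"
  have "S / k * (?W - w (partner T r) r) + q * w (partner T r) r
      \<le> order_mean (step_mean T r (weight w)) (T - {r})"
    if r: "r \<in> T" "T - {r} \<subseteq> R" "card (T - {r}) = k" for r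
  proof -
    let ?p = "partner T r"
    have p: "?p \<in> L" using partner(2)[OF T r(1)] .
    have wp: "0 \<le> w ?p r" using w_nonneg[OF p] T r(1) by blast
    have "S / k * (?W - w ?p r) \<le> S / k * weight w (opt (T - {r}))"
      using weight_opt_remove[OF T r(1)] S by (intro mult_left_mono) auto
    also have "\<dots> \<le> order_mean (weight w) (T - {r})"
      using Suc.hyps(1)[of "T - {r}"] r by (simp add: S_def)
    finally have 1: "S / k * (?W - w ?p r) \<le> order_mean (weight w) (T - {r})" .
    have 2: "q * w ?p r \<le> of_bool (n div 4 \<le> Suc k) * (w ?p r * order_mean (ev1 ?p) (T - {r}))"
    proof (cases "n div 4 \<le> Suc k")
      case True
      then have "b k \<le> order_mean (ev1 ?p) (T - {r})"
        using low[OF kn True] r p by (auto simp: low1_def)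
      then show ?thesis using True wp by (simp add: q_def mult.commute[of "b k"] mult_left_mono)
    qed (simp add: q_def)
    have "S / k * (?W - w ?p r) + q * w ?p r \<le> order_mean (weight w) (T - {r}) +
        of_bool (n div 4 \<le> Suc k) * (w ?p r * order_mean (ev1 ?p) (T - {r}))"
      using 1 2 by linarith
    also have "\<dots> = order_mean (\<lambda>M. weight w M +
        of_bool (n div 4 \<le> Suc k) * (w ?p r * ev1 ?p M)) (T - {r})"
      using r(2) by (simp only: order_mean_add order_mean_cmult)
    also have "\<dots> \<le> order_mean (step_mean T r (weight w)) (T - {r})"
      using step_weight[OF _ T r(1)] card by (intro order_mean_mono r(2)) simp
    finally show ?thesis .
  qed
  from order_mean_ge[OF T card this]
  have "(\<Sum>r\<in>T. S / k * (?W - w (partner T r) r) + q * w (partner T r) r) / Suc k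
    \<le> order_mean (weight w) T" .
  moreover have "(\<Sum>r\<in>T. S / k * (?W - w (partner T r) r) + q * w (partner T r) r) =
      S / k * (Suc k * ?W - ?W) + q * ?W"
    by (simp only: sum.distrib sum_distrib_left[symmetric] sum_subtractf weight_opt[OF T, symmetric]
        sum_constant card)
  \<comment> \<open>For \<open>k = 0\<close> the division by zero is harmless, as \<open>S\<close>
    is then an empty sum.\<close>
  moreover have "S / k * (Suc k * ?W - ?W) = S * ?W"
    by (cases "k = 0") (simp_all add: S_def algebra_simps)
  moreover have "(\<Sum>k<Suc k. of_bool (n div 4 \<le> Suc k) * b k) = S + q"
    by (simp add: S_def q_def)
  ultimately show ?case unfolding card by (simp add: distrib_right del: sum.lessThan_Suc)
qed

lemma OPT_eq: "OPT L R w = weight w (opt R)"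
proof -
  have o: "is_max_matching L R w (opt R)" by (rule opt_max) simp
  have "{M. cap_matching L R M \<and> matches_all R M} \<subseteq> Pow (L \<times> R)"
    by (auto simp: cap_matching_def)
  then have "finite {M. cap_matching L R M \<and> matches_all R M}"
    using finite_L finite_R by (meson finite_Pow_iff finite_SigmaI finite_subset)
  then show ?thesis
    unfolding OPT_def using o by (intro Max_eqI) (auto simp: is_max_matching_def)
qed

lemma expectation_random_order:
  "measure_pmf.expectation (alg2_random_order L R opt) g = order_mean g R"
proof -
  have run: "alg2 L opt xs = map_pmf fst (run (rev xs))" "finite (set_pmf (run (rev xs)))"
    if "xs \<in> permutations_of_set R" for xs
  proof -
    have xs: "set xs = R" "distinct xs" "length xs = n"
      using that card_R by (auto dest: permutations_of_setD simp: length_finite_permutations_of_set)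
    show "alg2 L opt xs = map_pmf fst (run (rev xs))"
      using alg2_state_eq_run[of xs n] xs(3) by (simp add: alg2_def)
    show "finite (set_pmf (run (rev xs)))"
      using run_valid[of "rev xs"] xs by simp
  qed
  have "measure_pmf.expectation (alg2_random_order L R opt) g =
    (\<Sum>xs\<in>permutations_of_set R. measure_pmf.expectation (alg2 L opt xs) g) / fact n"
    unfolding alg2_random_order_def using finite_R run card_R
    by (subst pmf_expectation_bind_pmf_of_set) (auto simp: sum_distrib_left divide_inverse_commute)
  also have "(\<Sum>xs\<in>permutations_of_set R. measure_pmf.expectation (alg2 L opt xs) g) =
    (\<Sum>xs\<in>permutations_of_set R. measure_pmf.expectation (run (rev xs)) (\<lambda>s. g (fst s)))"
    using run by (intro sum.cong) auto
  also have "\<dots> = (\<Sum>ys\<in>rev ` permutations_of_set R. measure_pmf.expectation (run ys) (\<lambda>s. g (fst s)))"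
    by (subst sum.reindex) (auto simp: inj_on_def)
  finally show ?thesis by (simp add: order_mean_def card_R)
qed

lemma competitive_ratio:
  fixes b :: "nat \<Rightarrow> real" and c :: real
  assumes "\<And>k. k < n \<Longrightarrow> n div 4 \<le> Suc k \<Longrightarrow> low1 k (b k)" "\<And>k. 0 \<le> b k"
    and "c * n \<le> (\<Sum>k<n. of_bool (n div 4 \<le> Suc k) * b k)"
  shows "c * OPT L R w \<le> measure_pmf.expectation (alg2_random_order L R opt) (weight w)"
proof (cases "n = 0")
  case True
  then have "R = {}" using card_R finite_R by (metis card_0_eq)
  have "weight w (opt R) = 0" unfolding weight_opt[OF order_refl] unfolding \<open>R = {}\<close> by simp
  moreover have "order_mean (weight w) R = 0"
    unfolding \<open>R = {}\<close> order_mean_empty by (simp add: weight_def)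
  ultimately show ?thesis by (simp add: expectation_random_order OPT_eq)
next
  case False
  have "0 \<le> weight w (opt R)"
    unfolding weight_opt[OF order_refl] using partner(2)[OF order_refl]
    by (intro sum_nonneg w_nonneg) auto
  moreover have "c \<le> (\<Sum>k<n. of_bool (n div 4 \<le> Suc k) * b k) / n"
    using assms(3) False by (simp add: field_simps)
  ultimately have "c * weight w (opt R) \<le>
      (\<Sum>k<n. of_bool (n div 4 \<le> Suc k) * b k) / n * weight w (opt R)"
    by (intro mult_right_mono)
  also have "\<dots> \<le> order_mean (weight w) R"
    using order_mean_weight[OF assms(1,2) order_refl] card_R by simp
  finally show ?thesis by (simp add: expectation_random_order OPT_eq)
qed

section \<open>The competitive ratio\<close>

text \<open>The vertices chosen during exploration form a uniform sample without replacement, whence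
  the hypergeometric closed forms. No vertex is taken twice, so a free place is certain and the
  bounds for \<open>low01\<close> and \<open>low0\<close> agree.\<close>

lemma explore_bounds:
  assumes "k < n div 4"
  shows "low0 k ((real m - real k) / real m) \<and> low1 k 1 \<and> low01 k ((real m - real k) / real m) \<and>
    low00 k ((real m - real k) * (real m - real k - 1) / (real m * (real m - 1)))"
  using assms
proof (induction k)
  case 0
  then have "real m - 1 \<noteq> 0" "real m \<noteq> 0" using n_eq by auto
  then show ?case using low_zero by simp
next
  case (Suc k)
  then have km: "k < m" "k + 2 \<le> m" "Suc k < n div 4" using n_eq by auto
  note e = explore[OF km(3,1)]
  have z: "real m - real k \<noteq> 0" using km by simp
  have 1: "(real m - real k) / real m * (1 - 1 / (real m - real k)) = (real m - real (Suc k)) / real m"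
    using mult_one_minus_divide[OF z, of 1] by (simp add: mult.commute)
  have 2: "(real m - real k) * (real m - real k - 1) / (real m * (real m - 1)) * (1 - 2 / (real m - real k))
     = (real m - real (Suc k)) * (real m - real (Suc k) - 1) / (real m * (real m - 1))"
  proof -
    have "a * b / c * d = a * d * b / c" for a b c d :: real by simp
    note eq = this[of "real m - real k" "real m - real k - 1" "real m * (real m - 1)"
        "1 - 2 / (real m - real k)"]
    have "real m - real (Suc k) = real m - real k - 1" "real m - real k - 1 - 1 = real m - real k - 2"
      by simp_all
    then show ?thesis unfolding eq mult_one_minus_divide[OF z] by (simp only: mult.commute)
  qed
  show ?case
    using e(1)[of "(real m - real k) / real m"] e(2)[of 1] e(3)[of "(real m - real k) / real m"]
      e(4)[OF _ km(2), of "(real m - real k) * (real m - real k - 1) / (real m * (real m - 1))"]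
      Suc.IH km(3) unfolding 1 2 by simp
qed

context
  fixes s :: nat
  assumes s: "11 \<le> s" and m: "m = 2 * s + 2 \<or> m = 2 * s + 3"
begin

text \<open>
  \<open>f0\<close>, \<open>f01\<close> and \<open>f00\<close> bound the probabilities of \<open>ev0 l\<close>, of \<open>ev0 l\<close> and \<open>ev1 l'\<close>, and of \<open>ev0 l\<close> and
  \<open>ev0 l'\<close>. The factors \<open>fall2\<close> and \<open>fall4\<close> are the probabilities of never being a partner; \<open>f0\<close> is
  only a subsolution of its recursion, chosen because it can be summed.
\<close>

definition f00 :: "real \<Rightarrow> real" where
  "f00 x = fall4 s x * ((real m - x) * (real m - x - 1) / (real m * (real m - 1)))"

definition f01 :: "nat \<Rightarrow> real" where
  "f01 k = fall4 s k * ((real m - real k) / real m) * eta s m k"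

definition f0 :: "real \<Rightarrow> real" where
  "f0 x = fall2 s x * ((real m - x) / real m) * ((x + 3) / (real s + 3))"

lemma div4: "n div 4 = Suc s"
  using m n_eq by auto

lemma m_pos: "1 < real m" "real m \<noteq> 0" "real m - 1 \<noteq> 0"
  using m s by auto

lemma bounds_at_start:
  "low0 s (f0 s)" "low1 s (low1_bound s m s)" "low01 s (f01 s)" "low00 s (f00 s)"
proof -
  have "fall2 s s = 1" "fall4 s s = 1" using s by (auto simp: fall2_def fall4_def)
  then show "low0 s (f0 s)" "low1 s (low1_bound s m s)" "low01 s (f01 s)" "low00 s (f00 s)"
    using explore_bounds[of s] s
    by (simp_all add: div4 f0_def f01_def f00_def eta_def low1_bound_def)
qed

context
  fixes k :: nat
  assumes k: "s \<le> k" "k < m"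
begin

private lemma xs: "11 \<le> real k" "real k + 1 \<le> real m" "real m - real k \<noteq> 0" "11 \<le> real s"
    "real s \<le> real k" "real m \<le> 2 * real s + 3"
  using k s m by auto

private lemma f00_Suc: "f00 (real k + 1) = (1 - 4 / Suc k) * (f00 k * (1 - 2 / (real m - real k)))"
proof -
  have f4: "fall4 s (real k + 1) = (1 - 4 / Suc k) * fall4 s k"
    using fall4_Suc[of k s] xs by (simp add: add.commute)
  have "x * (a * b / c) * d = x * (b * (a * d) / c)" for a b c d x :: real by (simp add: mult_ac)
  note eq = this[of _ "real m - real k" "real m - real k - 1"]
  show ?thesis
    unfolding f00_def f4 eq mult_one_minus_divide[OF xs(3)] by (simp add: diff_diff_eq mult.assoc)
qed

private lemma f01_early: "f01 k * (1 - 1 / (real m - real k)) = fall4 s k * ((real m - (real k + 1)) / real m) * eta s m k"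
proof -
  have "x * (a / c) * e * d = x * (a * d / c) * e" for a c d e x :: real by (simp add: mult_ac)
  note eq = this[of _ "real m - real k"]
  show ?thesis unfolding f01_def eq mult_one_minus_divide[OF xs(3)] by (simp add: diff_diff_eq)
qed

text \<open>Needed as \<open>e \<le> \<beta>\<close> in \<open>exploit_01\<close>; it holds because
  \<open>eta\<close> is at least one.\<close>

private lemma f00_le: "f00 k \<le> f01 k * (1 - 1 / (real m - real k))"
proof -
  have "(real m - real k) / (real m - 1) \<le> eta s m k"
  proof -
    have "real m - 1 \<le> eta s m k * (real m - 1)"
      using mult_right_mono[of 1 "eta s m k" "real m - 1"] eta_ge_one[of s k m] s k m_pos by simp
    then have "real m - real k \<le> eta s m k * (real m - 1)" using xs by linarith
    then show ?thesis using m_pos by (simp add: divide_le_eq)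
  qed
  then have "fall4 s k * ((real m - (real k + 1)) / real m) * ((real m - real k) / (real m - 1)) \<le>
      fall4 s k * ((real m - (real k + 1)) / real m) * eta s m k"
    using fall_nonneg(2)[of s k] xs m_pos by (intro mult_left_mono mult_nonneg_nonneg) auto
  moreover have "x * (a / c) * (b / c') = x * (b * a / (c * c'))" for a b c c' x :: real
    by (simp add: mult_ac)
  ultimately show ?thesis unfolding f01_early f00_def by (simp only: diff_diff_eq)
qed

private lemma f01_Suc:
  "f01 (Suc k) = 2 / Suc k * f00 k + (1 - 4 / Suc k) * (f01 k * (1 - 1 / (real m - real k)))"
proof -
  have eta: "eta s m (Suc k) = eta s m k + 2 * (real m - real k) / ((real k - 3) * (real m - 1))"
    using k by (simp add: eta_def)
  have f4: "fall4 s (Suc k) = (1 - 4 / Suc k) * fall4 s k"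
    using fall4_Suc[of k s] xs by (simp add: add.commute)
  have alg: "x * (a / c) * (2 * b / (d * c')) = x * (2 / d) * (b * a / (c * c'))"
    for a b c c' d x :: real by (simp add: mult_ac)
  have "(1 - 4 / real (Suc k)) * (2 / (real k - 3)) = 2 / Suc k"
    using xs by (simp add: divide_simps)
  then have "fall4 s (Suc k) * (2 / (real k - 3)) = 2 / Suc k * fall4 s k"
    unfolding f4 by (metis mult.assoc mult.commute)
  then have "fall4 s (Suc k) * ((real m - (real k + 1)) / real m) *
      (2 * (real m - real k) / ((real k - 3) * (real m - 1))) = 2 / Suc k * f00 k"
    unfolding alg f00_def by (simp only: mult.assoc diff_diff_eq)
  moreover have "fall4 s (Suc k) * ((real m - (real k + 1)) / real m) * eta s m k =
      (1 - 4 / Suc k) * (f01 k * (1 - 1 / (real m - real k)))"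
    unfolding f4 f01_early by (simp only: mult.assoc)
  moreover have "real m - real (Suc k) = real m - (real k + 1)" by simp
  then have "f01 (Suc k) = fall4 s (Suc k) * ((real m - (real k + 1)) / real m) * eta s m k +
      fall4 s (Suc k) * ((real m - (real k + 1)) / real m) *
      (2 * (real m - real k) / ((real k - 3) * (real m - 1)))"
    by (simp only: f01_def eta distrib_left)
  ultimately show ?thesis by linarith
qed

text \<open>From \<open>k\<close> to \<open>k + 1\<close> the factor
  \<open>(x + 3) / (s + 3)\<close> gains \<open>1 / (s + 3)\<close>. The term
  \<open>f01 k / (m - k)\<close> has to cover this gain, which after cancellation of common factors
  is \<open>eta_ge\<close>.\<close>

private lemma f0_le:
  "f0 (real k + 1) \<le> (1 - 2 / Suc k) * (f0 k * (1 - 1 / (real m - real k)) + f01 k / (real m - real k))"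
proof -
  let ?K = "(real s + 3) * (real s - 2) * (real s - 3)"
  have p: "0 < (real k - 2) * (real k - 3)" "0 < ?K" "0 < real s + 3" using xs by auto
  have "(real m - real k - 1) / (real s + 3) * ((real k - 2) * (real k - 3)) \<le>
      eta s m k * ((real s - 2) * (real s - 3))"
    using eta_ge[OF s m k] p(3) by (simp add: divide_le_eq mult_ac)
  then have "fall2 s k * ((real m - real k - 1) / (real s + 3)) * ((real k - 2) * (real k - 3)) \<le>
      fall2 s k * (eta s m k * ((real s - 2) * (real s - 3)))"
    unfolding mult.assoc using fall_nonneg(1)[of s k] xs by (intro mult_left_mono) auto
  also have "\<dots> = fall4 s k * eta s m k * ((real k - 2) * (real k - 3))"
    using fall4_eq[of k s] xs by (simp add: mult_ac)
  finally have main: "fall2 s k * ((real m - real k - 1) / (real s + 3)) \<le> fall4 s k * eta s m k"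
    using p(1) by (rule mult_right_le_imp_le)
  have "x * (a / c) * e * d = x * (a * d / c) * e" for a c d e x :: real by (simp add: mult_ac)
  note eq = this[of _ "real m - real k"]
  have "f0 k * (1 - 1 / (real m - real k)) =
      fall2 s k * ((real m - (real k + 1)) / real m) * ((real k + 3) / (real s + 3))"
    unfolding f0_def eq mult_one_minus_divide[OF xs(3)] by (simp add: diff_diff_eq)
  moreover have "f01 k / (real m - real k) = fall4 s k * eta s m k / real m"
    using xs by (simp add: f01_def)
  moreover have "fall2 s k * ((real m - (real k + 1)) / real m) * ((real k + 1 + 3) / (real s + 3)) =
     fall2 s k * ((real m - (real k + 1)) / real m) * ((real k + 3) / (real s + 3)) +
     fall2 s k * ((real m - real k - 1) / (real s + 3)) / real m"
  proof -
    have "p * (a / c) * ((x + 1 + 3) / d) = p * (a / c) * ((x + 3) / d) + p * (a / d) / c"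
      for a c d p x :: real
      by (simp add: add_divide_distrib distrib_left mult_ac)
    then show ?thesis by (simp only: diff_diff_eq)
  qed
  moreover have "fall2 s k * ((real m - real k - 1) / (real s + 3)) / real m \<le>
      fall4 s k * eta s m k / real m"
    using main m_pos by (intro divide_right_mono) auto
  ultimately have "fall2 s k * ((real m - (real k + 1)) / real m) * ((real k + 1 + 3) / (real s + 3)) \<le>
      f0 k * (1 - 1 / (real m - real k)) + f01 k / (real m - real k)"
    by linarith
  then have "(1 - 2 / Suc k) * (fall2 s k * ((real m - (real k + 1)) / real m) * ((real k + 1 + 3) / (real s + 3)))
    \<le> (1 - 2 / Suc k) * (f0 k * (1 - 1 / (real m - real k)) + f01 k / (real m - real k))"
    using xs by (intro mult_left_mono) auto
  then show ?thesis
    using fall2_Suc[of k s] xs by (simp add: f0_def mult.assoc add.commute)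
qed

text \<open>Needed as \<open>f \<le> b\<close> in \<open>exploit_1\<close>.\<close>

private lemma f0_le_low1_bound: "f0 k \<le> low1_bound s m k"
proof -
  have "0 \<le> (real k - real s)\<^sup>2 + real s * real s + 3 * real s + (2 * real s + 3 - real m) * (real k - real s)"
    using xs by (intro add_nonneg_nonneg mult_nonneg_nonneg) auto
  then have "(real m - real k) * (real k + 3) \<le> real m * (real s + 3)"
    by (simp add: power2_eq_square algebra_simps)
  then have "(real m - real k) / real m * ((real k + 3) / (real s + 3)) \<le> 1"
    using xs m_pos by (simp add: divide_le_eq)
  also have "1 \<le> 1 + (real k - real s) * (2 * real m - real k - real s + 1) / (real m * (real s + 1))"
    using xs m_pos by simp
  finally show ?thesis
    unfolding f0_def low1_bound_eq mult.assoc[of "fall2 s k"]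
    using fall_nonneg(1)[of s k] xs by (intro mult_left_mono) auto
qed

private lemma low1_bound_le:
  "low1_bound s m (real k + 1) \<le> 2 / Suc k * f0 k + (1 - 2 / Suc k) * low1_bound s m k"
proof -
  let ?D = "real m * (real s + 1)"
  let ?b = "\<lambda>x. 1 + (x - real s) * (2 * real m - x - real s + 1) / ?D"
  have D: "?D \<noteq> 0" using m_pos by auto
  have "?b (real k + 1) = ?b k + 2 * (real m - real k) / ?D"
    unfolding add.assoc add_left_cancel add_divide_distrib[symmetric] by (simp add: algebra_simps)
  moreover have "(1 - 2 / real (Suc k)) * (2 * (real m - real k) / ?D) \<le>
      2 / Suc k * ((real m - real k) / real m * ((real k + 3) / (real s + 3)))"
  proof -
    \<comment> \<open>This amounts to \<open>k \<le> 2 * s + 3\<close>; the summand \<open>1\<close>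
      in the factor \<open>s + 1\<close> of \<open>low1_bound\<close> provides the room.\<close>
    have "(real k - 1) / (real s + 1) \<le> (real k + 3) / (real s + 3)"
      using xs by (simp add: divide_simps) (simp add: algebra_simps)
    then have "2 / Suc k * ((real m - real k) / real m) * ((real k - 1) / (real s + 1)) \<le>
        2 / Suc k * ((real m - real k) / real m) * ((real k + 3) / (real s + 3))"
      using xs m_pos by (intro mult_left_mono mult_nonneg_nonneg) auto
    moreover have "(1 - 2 / real (Suc k)) = (real k - 1) / Suc k" by (simp add: field_simps)
    moreover have "a / b * (2 * c / (d * e)) = 2 / b * (c / d) * (a / e)" for a b c d e :: real
      by (simp add: mult_ac)
    ultimately show ?thesis by (simp only: mult.assoc)
  qed
  ultimately have "(1 - 2 / real (Suc k)) * ?b (real k + 1) \<le>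
      2 / Suc k * ((real m - real k) / real m * ((real k + 3) / (real s + 3))) + (1 - 2 / real (Suc k)) * ?b k"
    by (simp add: distrib_left)
  then have "fall2 s k * ((1 - 2 / real (Suc k)) * ?b (real k + 1)) \<le> fall2 s k *
     (2 / Suc k * ((real m - real k) / real m * ((real k + 3) / (real s + 3))) + (1 - 2 / real (Suc k)) * ?b k)"
    using fall_nonneg(1)[of s k] xs by (intro mult_left_mono) auto
  moreover have "fall2 s (real k + 1) = (1 - 2 / Suc k) * fall2 s k"
    using fall2_Suc[of k s] xs by (simp add: add.commute)
  then have "low1_bound s m (real k + 1) = fall2 s k * ((1 - 2 / real (Suc k)) * ?b (real k + 1))"
    unfolding low1_bound_eq by (simp only: mult_ac)
  moreover have "2 / Suc k * f0 k + (1 - 2 / Suc k) * low1_bound s m k = fall2 s k *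
     (2 / Suc k * ((real m - real k) / real m * ((real k + 3) / (real s + 3))) + (1 - 2 / real (Suc k)) * ?b k)"
  proof -
    have "a * (p * b) + c * (p * d) = p * (a * b + c * d)" for a b c d p :: real
      by (simp add: algebra_simps)
    then show ?thesis unfolding low1_bound_eq f0_def mult.assoc[of "fall2 s k"] .
  qed
  ultimately show ?thesis by linarith
qed

lemma bounds_step:
  assumes "low0 k (f0 k)" "low1 k (low1_bound s m k)" "low01 k (f01 k)" "low00 k (f00 k)"
  shows "low0 (Suc k) (f0 (Suc k))" "low1 (Suc k) (low1_bound s m (Suc k))"
    "low01 (Suc k) (f01 (Suc k))" "low00 (Suc k) (f00 (Suc k))"
proof -
  have q: "n div 4 \<le> Suc k" using div4 k by simp
  have f00: "0 \<le> f00 k" and f0: "0 \<le> f0 k" and f01: "0 \<le> f01 k"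
    using fall_nonneg[of s k] xs m_pos eta_ge_one[of s k m] s k
    by (auto simp: f00_def f0_def f01_def)
  have z: "0 \<le> 1 - 1 / (real m - real k)" using xs by simp
  show "low0 (Suc k) (f0 (Suc k))"
    by (rule low_mono(1)[OF _ exploit_0[OF q k(2) assms(1,3) refl]])
      (use f0_le f0 f01 z xs in \<open>auto simp: add.commute\<close>)
  show "low1 (Suc k) (low1_bound s m (Suc k))"
    by (rule low_mono(2)[OF _ exploit_1[OF q k(2) assms(1,2) f0_le_low1_bound]])
      (use low1_bound_le in \<open>simp add: add.commute\<close>)
  show "low01 (Suc k) (f01 (Suc k))"
    unfolding f01_Suc
    by (rule exploit_01[OF q k(2) assms(3,4) refl f00_le]) (use f01 z in auto)
  show "low00 (Suc k) (f00 (Suc k))"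
  proof (cases "k + 2 \<le> m")
    case True
    then show ?thesis
      using exploit_00[OF q True assms(4) f00 refl] f00_Suc by (simp add: add.commute)
  next
    \<comment> \<open>Here \<open>k + 1 = m\<close>, so \<open>exploit_00\<close> does not apply,
      but \<open>f00\<close> vanishes at \<open>m\<close>.\<close>
    case False
    then have "real m - real (Suc k) = 0" using k by simp
    then have "f00 (Suc k) = 0" by (simp only: f00_def mult_zero_left mult_zero_right div_0)
    then show ?thesis using low_nonneg(3) by simp
  qed
qed

end

lemma bounds:
  assumes "s \<le> k" "k \<le> m"
  shows "low0 k (f0 k) \<and> low1 k (low1_bound s m k) \<and> low01 k (f01 k) \<and> low00 k (f00 k)"
  using assms
proof (induction k rule: dec_induct)
  case base
  then show ?case using bounds_at_start by simp
next
  case (step k)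
  then show ?case using bounds_step[of k] by simp
qed

lemma low1_bound_nonneg:
  assumes "s \<le> k" "k \<le> m"
  shows "0 \<le> low1_bound s m k"
  using assms s by (simp add: low1_bound_def)

text \<open>This solves the recursion of \<open>exploit_1_late\<close> from \<open>m\<close> on. The
  factors \<open>1 - 2 / Suc k\<close> and \<open>1 - 1 / (n - k)\<close> both telescope, and
  \<open>m - 1\<close> normalises the value at \<open>m\<close> to
  \<open>low1_bound s m m\<close>.\<close>

definition late :: "nat \<Rightarrow> real" where
  "late k = low1_bound s m m * (real m - 1) * ((2 * real m - real k) / (real k * (real k - 1)))"

lemma late_nonneg: "m \<le> k \<Longrightarrow> k \<le> 2 * m \<Longrightarrow> 0 \<le> late k"
  unfolding late_def using low1_bound_nonneg[of m] m s m_pos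
  by (intro mult_nonneg_nonneg divide_nonneg_nonneg) auto

lemma late_bounds:
  assumes "m \<le> k" "k < n"
  shows "low1 k (late k)"
  using assms
proof (induction k rule: dec_induct)
  case base
  have "late m = low1_bound s m m" using m_pos by (simp add: late_def)
  then show ?case using bounds[of m] m by auto
next
  case (step k)
  have k: "1 < real k" "real k < real n" using step m s by auto
  have q: "n div 4 \<le> Suc k" using div4 step m by auto
  have "low1 (Suc k) ((1 - 2 / Suc k) * (late k * (1 - 1 / (real n - real k))))"
    using step late_nonneg[of k] n_eq by (intro exploit_1_late[OF q]) auto
  moreover have "(1 - 2 / Suc k) * (late k * (1 - 1 / (real n - real k))) = late (Suc k)"
  proof -
    have eq1: "(2 * real m - real k) * (1 - 1 / (real n - real k)) = 2 * real m - real (Suc k)"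
      using k by (simp add: n_eq right_diff_distrib)
    have eq2: "(1 - 2 / Suc k) / (real k * (real k - 1)) = 1 / (real (Suc k) * (real (Suc k) - 1))"
      using k by (simp add: divide_simps)
    have alg: "a * (c * (x / d) * e) = c * ((x * e) * (a / d))" for a c d e x :: real
      by (simp add: mult_ac)
    show ?thesis unfolding late_def alg eq1 eq2 by simp
  qed
  ultimately show ?case by simp
qed

lemma competitive_large:
  "50 / 231 * OPT L R w \<le> measure_pmf.expectation (alg2_random_order L R opt) (weight w)"
proof (rule competitive_ratio)
  \<comment> \<open>\<open>b k\<close> bounds the chance of a free place just before arrival
    \<open>k + 1\<close>. It is padded with zeros because \<open>competitive_ratio\<close> asks for
    non-negative values at all \<open>k\<close>.\<close>
  define b where "b k = (if k < s then 0 else if k < m then low1_bound s m k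
    else if k < n then late k else 0)" for k
  show "low1 k (b k)" if "k < n" "n div 4 \<le> Suc k" for k
    using that bounds[of k] late_bounds[of k] by (auto simp: b_def div4)
  show "0 \<le> b k" for k
    using low1_bound_nonneg[of k] late_nonneg[of k] by (auto simp: b_def n_eq)
  have "(\<Sum>k<n. of_bool (n div 4 \<le> Suc k) * b k) = (\<Sum>k<n. b k)"
    by (intro sum.cong) (auto simp: b_def div4)
  also have "\<dots> = (\<Sum>k=s..<n. b k)"
    by (intro sum.mono_neutral_right) (auto simp: b_def)
  also have "\<dots> = (\<Sum>k=s..<m. b k) + (\<Sum>k=m..<2*m. b k)"
    using m by (subst sum.atLeastLessThan_concat) (auto simp: n_eq)
  also have "(\<Sum>k=s..<m. b k) = (\<Sum>k=s..<m. low1_bound s m k)"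
    by (intro sum.cong) (auto simp: b_def)
  also have "(\<Sum>k=m..<2*m. b k) = (\<Sum>k=m..<2*m. late k)"
    using m by (intro sum.cong) (auto simp: b_def n_eq)
  \<comment> \<open>The two sums give \<open>0.8663 * s\<close> plus \<open>1\<close> or
    \<open>1.44\<close>, against \<open>50 / 231\<close> times \<open>4 * s + 4\<close> or
    \<open>4 * s + 6\<close>.\<close>
  finally show "50 / 231 * real n \<le> (\<Sum>k<n. of_bool (n div 4 \<le> Suc k) * b k)"
    using first_half_sum[OF s m] second_half_sum[OF s m] m s
    by (auto simp: late_def n_eq)
qed

end

section \<open>Small instances and the combination of both cases\<close>

lemma small_run_bounds:
  assumes "k \<le> n"
  shows "case small_run m (n div 4) k of (f, b, S) \<Rightarrow> low0 k f \<and> low1 k b \<and> 0 \<le> f \<and> f \<le> b \<and>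
    S = (\<Sum>j<k. of_bool (n div 4 \<le> Suc j) * fst (snd (small_run m (n div 4) j)))"
  using assms
proof (induction k)
  case 0
  then show ?case using low_zero by simp
next
  case (Suc k)
  obtain f b S where fbS: "small_run m (n div 4) k = (f, b, S)" by (cases "small_run m (n div 4) k")
  have IH: "low0 k f" "low1 k b" "0 \<le> f" "f \<le> b"
    "S = (\<Sum>j<k. of_bool (n div 4 \<le> Suc j) * fst (snd (small_run m (n div 4) j)))"
    using Suc fbS by auto
  have two: "0 \<le> 1 - 2 / real (Suc k)" if "0 < k" using that by simp
  consider "Suc k < n div 4" | "n div 4 \<le> Suc k" "k < m" | "n div 4 \<le> Suc k" "m \<le> k" by linarith
  then show ?case
  proof cases
    case 1
    then have "k < m" using n_eq by auto
    then have z: "0 \<le> 1 - 1 / (real m - real k)" "1 - 1 / (real m - real k) \<le> 1" by auto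
    have "f * (1 - 1 / (real m - real k)) \<le> f" using mult_left_mono[OF z(2) IH(3)] by simp
    then show ?thesis
      using 1 explore(1,2)[OF 1 \<open>k < m\<close>] IH z fbS by auto
  next
    case 2
    have z: "0 \<le> 1 - 1 / (real m - real k)" "1 - 1 / (real m - real k) \<le> 1" using 2 by auto
    define f' where "f' = (1 - 2 / real (Suc k)) * (f * (1 - 1 / (real m - real k)))"
    define b' where "b' = 2 / real (Suc k) * f + (1 - 2 / real (Suc k)) * b"
    \<comment> \<open>Taking \<open>h = 0\<close> drops the joint bound and leaves the plain
      recursion.\<close>
    have "low0 (Suc k) f'"
      unfolding f'_def using 2 IH low_nonneg(2) z by (intro exploit_0[of k f 0]) auto
    then have f': "low0 (Suc k) (max 0 f')" using low_nonneg(1) by (simp add: max_def)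
    have b': "low1 (Suc k) b'"
      unfolding b'_def using 2 IH by (intro exploit_1) auto
    \<comment> \<open>At \<open>k = 0\<close> the factor \<open>1 - 2 / Suc k\<close> is
      \<open>-1\<close>. This is why the recursion truncates at \<open>0\<close> and why the case is
      treated separately.\<close>
    have "max 0 f' \<le> b'"
    proof (cases "k = 0")
      case True
      then show ?thesis using fbS z by (simp add: f'_def b'_def)
    next
      case False
      have "f * (1 - 1 / (real m - real k)) \<le> f" using mult_left_mono[OF z(2) IH(3)] by simp
      then have "f' \<le> (1 - 2 / real (Suc k)) * b"
        unfolding f'_def using two False IH by (intro mult_left_mono) auto
      moreover have "0 \<le> 2 / real (Suc k) * f" using IH by simp
      moreover have "0 \<le> (1 - 2 / real (Suc k)) * b"
        using two False IH by (intro mult_nonneg_nonneg) auto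
      ultimately show ?thesis by (simp add: b'_def)
    qed
    then show ?thesis using 2 f' b' IH fbS by (simp add: f'_def b'_def)
  next
    case 3
    have kn: "k < n" using Suc.prems by simp
    have "0 < k" using 3 kn n_eq by auto
    have "low1 (Suc k) ((1 - 2 / Suc k) * (b * (1 - 1 / (real n - real k))))"
      using 3 IH kn by (intro exploit_1_late) auto
    moreover have "0 \<le> (1 - 2 / Suc k) * (b * (1 - 1 / (real n - real k)))"
      using two[OF \<open>0 < k\<close>] IH kn by (intro mult_nonneg_nonneg) auto
    ultimately show ?thesis using 3 low_nonneg(1) IH fbS by (simp add: n_eq)
  qed
qed

lemma competitive_small:
  assumes "50 / 231 * real n \<le> snd (snd (small_run m (n div 4) n))"
  shows "50 / 231 * OPT L R w \<le> measure_pmf.expectation (alg2_random_order L R opt) (weight w)"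
proof (rule competitive_ratio)
  define b where "b k = (if k < n then fst (snd (small_run m (n div 4) k)) else 0)" for k
  show "low1 k (b k)" if "k < n" for k
    using small_run_bounds[of k] that by (auto simp: b_def split: prod.splits)
  show "0 \<le> b k" for k
    using small_run_bounds[of k] by (auto simp: b_def split: prod.splits)
  show "50 / 231 * real n \<le> (\<Sum>k<n. of_bool (n div 4 \<le> Suc k) * b k)"
    using assms small_run_bounds[of n] by (auto simp: b_def split: prod.splits)
qed

lemma competitive:
  "50 / 231 * OPT L R w \<le> measure_pmf.expectation (alg2_random_order L R opt) (weight w)"
proof (cases "m \<le> 23")
  case True
  then show ?thesis using small_run_sum[of m] by (intro competitive_small) (simp add: n_eq)
next
  case False
  \<comment> \<open>Since \<open>m \<ge> 24\<close>, the number \<open>m div 2 - 1\<close> of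
    exploration steps is at least \<open>11\<close>.\<close>
  have "m = 2 * (m div 2 - 1) + 2 \<or> m = 2 * (m div 2 - 1) + 3" using False by presburger
  then show ?thesis using False by (intro competitive_large[of "m div 2 - 1"]) auto
qed

end

theorem theorem2:
  fixes L :: "'l set" and R :: "'r set" and n :: nat
    and w :: "'l \<Rightarrow> 'r \<Rightarrow> real"
    and opt :: "'r set \<Rightarrow> ('l, 'r) matching"
  assumes "finite L" and "finite R"
    and "card R = n" and "even n" and "card L = n div 2"
    and "\<And>l r. l \<in> L \<Longrightarrow> r \<in> R \<Longrightarrow> w l r \<ge> 0"
    and "\<And>R'. R' \<subseteq> R \<Longrightarrow> is_max_matching L R' w (opt R')"
  shows "measure_pmf.expectation (alg2_random_order L R opt) (weight w) \<ge> OPT L R w / 4.62"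
proof -
  interpret matching_instance L R n "n div 2" w opt
    using assms by unfold_locales auto
  have "OPT L R w / 4.62 = 50 / 231 * OPT L R w" by simp
  then show ?thesis using competitive by simp
qed

end
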